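(* Let $V$ be a vector space over $\mathbb{K}$ with finite positive dimension and let $A,A^{*}$ be a Leonard pair on $V$ that is of Bannai/Ito type, has diameter $d\geq 3$, and is totally bipartite or totally almost bipartite. Then there exist an irreducible $\mathcal{A}$-module structure on $V$ and nonzero scalars $\xi,\xi^{*}\in\mathbb{K}$ such that $A,A^{*}$ act on $V$ as $\xi x,\xi^{*}y$ respectively. If $A,A^{*}$ is totally bipartite then $V$ is of type $B$, and if $A,A^{*}$ is totally almost bipartite then $V$ is of type $AB$. There exist exactly four choices for the scalars $\xi,\xi^{*}$ and the $\mathcal{A}$-module structure. The scalars $\xi,\xi^{*}$ are each unique up to sign, and the $\mathcal{A}$-module structure is uniquely determined by $\xi,\xi^{*}$.
   Context: $\mathbb{K}$ is an algebraically closed field of characteristic zero. $\mathcal{A}$ is the unital associative $\mathbb{K}$-algebra with generators $x,y,z$ and relations $xy+yx=2z$, $yz+zy=2x$, $zx+xz=2y$. Type $B(d)$ ($d\ge 0$ even): an $\mathcal{A}$-module is of type $B(d)$ if it is isomorphic to the irreducible module with basis $\{v_i\}_{i=0}^d$ and, for $0\le i\le d$: $x.v_i=(-1)^i(d-2i)v_i$, $y.v_i=(d-i+1)v_{i-1}+(i+1)v_{i+1}$, $z.v_i=(-1)^{i-1}(d-i+1)v_{i-1}+(-1)^i(i+1)v_{i+1}$, with $v_{-1}=0=v_{d+1}$. Type $AB(d,n)$ ($d\ge 0$ an integer, $n\in\{0,x,y,z\}$): for $a\in\{x,y,z\}$ put $\widehat a(n)=1$ if $n\in\{0,a\}$ and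 $\widehat a(n)=-1$ otherwise. An $\mathcal{A}$-module is of type $AB(d,n)$ if it is isomorphic to the irreducible module with basis $\{v_i\}_{i=0}^d$ and, for $0\le i\le d$: $x.v_i=\widehat x(n)(-1)^{d+i}(2d-2i+1)v_i$, $y.v_i=\widehat y(n)(-1)^d\big((2d-i+2)v_{i-1}+(i+1)v_{i+1}\big)$, $z.v_i=\widehat z(n)\big((-1)^{i-1}(2d-i+2)v_{i-1}+(-1)^i(i+1)v_{i+1}\big)$, with $v_{-1}=0$, $v_{d+1}=v_d$. A module is of type $B$ if it is of type $B(d)$ for some even $d\ge0$, and of type $AB$ if it is of type $AB(d,n)$ for some $d\ge 0$, $n\in\{0,x,y,z\}$. A tridiagonal matrix is irreducible if every subdiagonal and superdiagonal entry is nonzero. A tridiagonal matrix $B$ indexed by $0,\dots,d$ is bipartite if $B_{ii}=0$ for all $i$; it is almost bipartite if exactly one of $B_{00},B_{dd}$ is nonzero and $B_{ii}=0$ for $1\le i\le d-1$. A Leonard pair on a $\mathbb{K}$-vector space $V$ is an ordered pair of linear maps $A,A^*:V\to V$ such that (1) there is a basis $\{v_i\}_{i=0}^d$ in which $A$ is diagonal and $A^*$ is irreducible tridiagonal, and (2) there is a basis $\{v_i^*\}_{i=0}^d$ in which $A^*$ is diagonal and $A$ is irreducible tridiagonal; its diameter is $d=\dim V-1$. It is totally bipartite (resp. totally almost bipartite) if the matrix of $A^*$ in (1) and the matrix of $A$ in (2) are both bipartite (resp. almost bipartite). With $\theta_i,\theta_i^*$ the eigenvalues of $A,A^*$ for $v_i,v_i^*$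 respectively, it is known that the expressions $\frac{\theta_{i-2}-\theta_{i+1}}{\theta_{i-1}-\theta_i}$, $\frac{\theta^*_{i-2}-\theta^*_{i+1}}{\theta^*_{i-1}-\theta^*_i}$ are equal and independent of $i$ for $2\le i\le d-1$; the Leonard pair is of Bannai/Ito type if this common value is $-1$. *)

theory Defs
  imports
    "HOL-Library.Poly_Mapping"
    "HOL-Computational_Algebra.Polynomial"
begin

section \<open>The algebra with generators x, y, z and relations xy+yx=2z, yz+zy=2x, zx+xz=2y\<close>

datatype gen = Gx | Gy | Gz

text \<open>Words in the generators, written additively (concatenation is \<open>+\<close>, the empty word is
  \<open>0\<close>), because the convolution product of \<^typ>\<open>'a \<Rightarrow>\<^sub>0 'b\<close> is taken over an additive
  monoid of exponents. The addition is not commutative.\<close>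

datatype gword = Word (letters: "gen list")

instantiation gword :: monoid_add
begin
definition zero_gword :: gword where "0 = Word []"
definition plus_gword :: "gword \<Rightarrow> gword \<Rightarrow> gword" where
  "u + v = Word (letters u @ letters v)"
instance
  by standard (simp_all add: zero_gword_def plus_gword_def)
end

text \<open>The free unital associative algebra on the three generators.\<close>

type_synonym 'k free_alg = "gword \<Rightarrow>\<^sub>0 'k"

definition free_gen :: "gen \<Rightarrow> 'k::field free_alg" where
  "free_gen g = Poly_Mapping.single (Word [g]) 1"

inductive_set relation_ideal :: "('k::field free_alg) set" where
  xy: "free_gen Gx * free_gen Gy + free_gen Gy * free_gen Gx - 2 * free_gen Gz \<in> relation_ideal"
| yz: "free_gen Gy * free_gen Gz + free_gen Gz * free_gen Gy - 2 * free_gen Gx \<in> relation_ideal"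
| zx: "free_gen Gz * free_gen Gx + free_gen Gx * free_gen Gz - 2 * free_gen Gy \<in> relation_ideal"
| zero: "0 \<in> relation_ideal"
| add: "p \<in> relation_ideal \<Longrightarrow> q \<in> relation_ideal \<Longrightarrow> p + q \<in> relation_ideal"
| left: "p \<in> relation_ideal \<Longrightarrow> r * p \<in> relation_ideal"
| right: "p \<in> relation_ideal \<Longrightarrow> p * r \<in> relation_ideal"

lemma relation_ideal_uminus: "p \<in> relation_ideal \<Longrightarrow> - p \<in> relation_ideal"
  using relation_ideal.left[of p "-1"] by simp

text \<open>The relation ideal lies in the kernel of the augmentation sending every generator to 0,
  i.e.\ taking the coefficient of the empty word; so it is proper.\<close>

lemma lookup_times_zero:
  fixes p q :: "'k::field free_alg"
  shows "Poly_Mapping.lookup (p * q) 0 = Poly_Mapping.lookup p 0 * Poly_Mapping.lookup q 0"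
proof -
  have zero_iff: "u + v = 0 \<longleftrightarrow> u = 0 \<and> v = 0" for u v :: gword
    by (cases u; cases v) (auto simp: zero_gword_def plus_gword_def)
  have inner: "(\<Sum>v. Poly_Mapping.lookup q v when u + v = 0)
      = (Poly_Mapping.lookup q 0 when u = 0)" for u
    by (cases "u = 0") (simp_all add: zero_iff)
  show ?thesis
    by (simp add: lookup_mult inner mult_when)
qed

lemma one_notin_relation_ideal: "(1 :: 'k::field free_alg) \<notin> relation_ideal"
proof -
  have gen: "Poly_Mapping.lookup (free_gen g :: 'k free_alg) 0 = 0" for g
    by (simp add: free_gen_def lookup_single zero_gword_def)
  have "Poly_Mapping.lookup p 0 = 0" if "p \<in> relation_ideal" for p :: "'k free_alg"
    using that
    by induction (simp_all add: lookup_times_zero lookup_add lookup_minus gen)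
  then show ?thesis
    by (metis lookup_one_zero zero_neq_one)
qed

lemma relation_ideal_uminus_iff: "- p \<in> relation_ideal \<longleftrightarrow> p \<in> relation_ideal"
  by (metis add.inverse_inverse relation_ideal_uminus)

definition ideal_cong :: "'k::field free_alg \<Rightarrow> 'k free_alg \<Rightarrow> bool" where
  "ideal_cong p q \<longleftrightarrow> p - q \<in> relation_ideal"

lemma equivp_ideal_cong: "equivp ideal_cong"
proof (rule equivpI)
  show "reflp ideal_cong"
    by (simp add: reflp_def ideal_cong_def relation_ideal.zero)
  show "symp ideal_cong"
    unfolding symp_def ideal_cong_def by (metis minus_diff_eq relation_ideal_uminus)
  show "transp ideal_cong"
    unfolding transp_def ideal_cong_def by (metis diff_add_cancel add_diff_eq relation_ideal.add)
qed

quotient_type (overloaded) 'k bi_alg = "'k::field free_alg" / ideal_cong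
  by (rule equivp_ideal_cong)

instantiation bi_alg :: (field) ring_1
begin

lift_definition zero_bi_alg :: "'a bi_alg" is 0 .

lift_definition one_bi_alg :: "'a bi_alg" is 1 .

lift_definition plus_bi_alg :: "'a bi_alg \<Rightarrow> 'a bi_alg \<Rightarrow> 'a bi_alg" is "(+)"
  unfolding ideal_cong_def by (metis add_diff_add relation_ideal.add)

lift_definition uminus_bi_alg :: "'a bi_alg \<Rightarrow> 'a bi_alg" is uminus
  unfolding ideal_cong_def by (metis minus_diff_minus relation_ideal_uminus)

lift_definition minus_bi_alg :: "'a bi_alg \<Rightarrow> 'a bi_alg \<Rightarrow> 'a bi_alg" is "(-)"
proof -
  fix p p' q q' :: "'a free_alg"
  assume "ideal_cong p p'" "ideal_cong q q'"
  moreover have "p - q - (p' - q') = (p - p') + - (q - q')" by simp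
  ultimately show "ideal_cong (p - q) (p' - q')"
    unfolding ideal_cong_def by (metis relation_ideal.add relation_ideal_uminus)
qed

lift_definition times_bi_alg :: "'a bi_alg \<Rightarrow> 'a bi_alg \<Rightarrow> 'a bi_alg" is "(*)"
proof -
  fix p p' q q' :: "'a free_alg"
  assume "ideal_cong p p'" "ideal_cong q q'"
  moreover have "p * q - p' * q' = (p - p') * q + p' * (q - q')" by (simp add: algebra_simps)
  ultimately show "ideal_cong (p * q) (p' * q')"
    unfolding ideal_cong_def
    by (metis relation_ideal.add relation_ideal.left relation_ideal.right)
qed

instance
  by (standard; transfer)
    (simp_all add: ideal_cong_def algebra_simps relation_ideal.zero
      relation_ideal_uminus_iff one_notin_relation_ideal)

end

definition smult_alg :: "'k::field \<Rightarrow> 'k bi_alg \<Rightarrow> 'k bi_alg" where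
  "smult_alg c a = abs_bi_alg (Poly_Mapping.single 0 c) * a"

lemma smult_alg_abs:
  "smult_alg c (abs_bi_alg p) = abs_bi_alg (Poly_Mapping.map ((*) c) p)"
  by (simp add: smult_alg_def times_bi_alg.abs_eq mult_map_scale_conv_mult)

definition alg_gen :: "gen \<Rightarrow> 'k::field bi_alg" where
  "alg_gen g = abs_bi_alg (free_gen g)"

lemma alg_gen_relations:
  "alg_gen Gx * alg_gen Gy + alg_gen Gy * alg_gen Gx = 2 * (alg_gen Gz :: 'k::field bi_alg)"
  "alg_gen Gy * alg_gen Gz + alg_gen Gz * alg_gen Gy = 2 * (alg_gen Gx :: 'k bi_alg)"
  "alg_gen Gz * alg_gen Gx + alg_gen Gx * alg_gen Gz = 2 * (alg_gen Gy :: 'k bi_alg)"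
proof -
  have two: "2 * a = a + a" for a :: "'k bi_alg"
    by (metis mult_2)
  have two': "2 * p = p + p" for p :: "'k free_alg"
    by (metis mult_2)
  note rel = relation_ideal.xy relation_ideal.yz relation_ideal.zx
  show "alg_gen Gx * alg_gen Gy + alg_gen Gy * alg_gen Gx = 2 * (alg_gen Gz :: 'k bi_alg)"
    "alg_gen Gy * alg_gen Gz + alg_gen Gz * alg_gen Gy = 2 * (alg_gen Gx :: 'k bi_alg)"
    "alg_gen Gz * alg_gen Gx + alg_gen Gx * alg_gen Gz = 2 * (alg_gen Gy :: 'k bi_alg)"
    using rel [where 'k='k]
    by (simp_all add: two two' alg_gen_def times_bi_alg.abs_eq plus_bi_alg.abs_eq
        bi_alg.abs_eq_iff ideal_cong_def)
qed

section \<open>Modules\<close>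

text \<open>An \<open>\<A>\<close>-module structure on the given vector space; it induces the given scalar
  multiplication on the space.\<close>

definition alg_module ::
    "('k::field \<Rightarrow> 'v::ab_group_add \<Rightarrow> 'v) \<Rightarrow>
      ('k bi_alg \<Rightarrow> 'v \<Rightarrow> 'v) \<Rightarrow> bool" where
  "alg_module scale act \<longleftrightarrow>
     (\<forall>a. Vector_Spaces.linear scale scale (act a)) \<and>
     (\<forall>a b v. act (a + b) v = act a v + act b v) \<and>
     (\<forall>c a v. act (smult_alg c a) v = scale c (act a v)) \<and>
     (\<forall>a b v. act (a * b) v = act a (act b v)) \<and>
     (\<forall>v. act 1 v = v)"

definition irreducible_module ::
    "('k::field \<Rightarrow> 'v::ab_group_add \<Rightarrow> 'v) \<Rightarrow>
      ('k bi_alg \<Rightarrow> 'v \<Rightarrow> 'v) \<Rightarrow> bool" where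
  "irreducible_module scale act \<longleftrightarrow>
     alg_module scale act \<and> (UNIV :: 'v set) \<noteq> {0} \<and>
     (\<forall>W. module.subspace scale W \<and> (\<forall>a. \<forall>w\<in>W. act a w \<in> W) \<longrightarrow> W = {0} \<or> W = UNIV)"

definition indexed_basis ::
    "('k::field \<Rightarrow> 'v::ab_group_add \<Rightarrow> 'v) \<Rightarrow>
      nat \<Rightarrow> (nat \<Rightarrow> 'v) \<Rightarrow> bool" where
  "indexed_basis scale d v \<longleftrightarrow>
     inj_on v {..d} \<and> \<not> module.dependent scale (v ` {..d}) \<and> module.span scale (v ` {..d}) = UNIV"

text \<open>In the two module types the basis vectors are indexed by integers, so that the boundary
  vectors \<open>v (-1)\<close> and \<open>v (d + 1)\<close> make sense. A module is isomorphic to the one given by the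
  displayed formulas iff it has itself a basis satisfying these formulas (transport along the
  isomorphism).\<close>

definition type_Bd ::
    "('k::field \<Rightarrow> 'v::ab_group_add \<Rightarrow> 'v) \<Rightarrow>
      nat \<Rightarrow> ('k bi_alg \<Rightarrow> 'v \<Rightarrow> 'v) \<Rightarrow> bool" where
  "type_Bd scale d act \<longleftrightarrow>
     irreducible_module scale act \<and>
     (\<exists>v :: int \<Rightarrow> 'v.
        indexed_basis scale d (\<lambda>i. v (int i)) \<and> v (- 1) = 0 \<and> v (int d + 1) = 0 \<and>
        (\<forall>i\<in>{0..int d}.
           act (alg_gen Gx) (v i) = scale ((- 1) powi i * of_int (int d - 2 * i)) (v i) \<and>
           act (alg_gen Gy) (v i) =
             scale (of_int (int d - i + 1)) (v (i - 1)) + scale (of_int (i + 1)) (v (i + 1)) \<and>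
           act (alg_gen Gz) (v i) =
             scale ((- 1) powi (i - 1) * of_int (int d - i + 1)) (v (i - 1)) +
             scale ((- 1) powi i * of_int (i + 1)) (v (i + 1))))"

definition type_B ::
    "('k::field \<Rightarrow> 'v::ab_group_add \<Rightarrow> 'v) \<Rightarrow>
      ('k bi_alg \<Rightarrow> 'v \<Rightarrow> 'v) \<Rightarrow> bool" where
  "type_B scale act \<longleftrightarrow> (\<exists>d. even d \<and> type_Bd scale d act)"

text \<open>The index set \<open>{0, x, y, z}\<close> of the types \<open>AB(d,n)\<close> is \<^typ>\<open>gen option\<close>, with
  \<^term>\<open>None\<close> for \<open>0\<close>.\<close>

definition hat :: "gen \<Rightarrow> gen option \<Rightarrow> 'k::field" where
  "hat a n = (if n = None \<or> n = Some a then 1 else - 1)"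

definition type_ABdn ::
    "('k::field \<Rightarrow> 'v::ab_group_add \<Rightarrow> 'v) \<Rightarrow>
      nat \<Rightarrow> gen option \<Rightarrow> ('k bi_alg \<Rightarrow> 'v \<Rightarrow> 'v) \<Rightarrow> bool" where
  "type_ABdn scale d n act \<longleftrightarrow>
     irreducible_module scale act \<and>
     (\<exists>v :: int \<Rightarrow> 'v.
        indexed_basis scale d (\<lambda>i. v (int i)) \<and> v (- 1) = 0 \<and> v (int d + 1) = v (int d) \<and>
        (\<forall>i\<in>{0..int d}.
           act (alg_gen Gx) (v i) =
             scale (hat Gx n * (- 1) powi (int d + i) * of_int (2 * int d - 2 * i + 1)) (v i) \<and>
           act (alg_gen Gy) (v i) =
             scale (hat Gy n * (- 1) ^ d)
               (scale (of_int (2 * int d - i + 2)) (v (i - 1)) +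
                scale (of_int (i + 1)) (v (i + 1))) \<and>
           act (alg_gen Gz) (v i) =
             scale (hat Gz n)
               (scale ((- 1) powi (i - 1) * of_int (2 * int d - i + 2)) (v (i - 1)) +
                scale ((- 1) powi i * of_int (i + 1)) (v (i + 1)))))"

definition type_AB ::
    "('k::field \<Rightarrow> 'v::ab_group_add \<Rightarrow> 'v) \<Rightarrow>
      ('k bi_alg \<Rightarrow> 'v \<Rightarrow> 'v) \<Rightarrow> bool" where
  "type_AB scale act \<longleftrightarrow> (\<exists>d n. type_ABdn scale d n act)"

section \<open>Leonard pairs\<close>

text \<open>A matrix indexed by \<open>0,\<dots>,d\<close> is a function of two natural numbers, of which only the
  entries with both indices at most \<open>d\<close> matter.\<close>

definition diagonal_mat :: "nat \<Rightarrow> (nat \<Rightarrow> nat \<Rightarrow> 'k::field) \<Rightarrow> bool" where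
  "diagonal_mat d B \<longleftrightarrow> (\<forall>i\<le>d. \<forall>j\<le>d. i \<noteq> j \<longrightarrow> B i j = 0)"

definition irred_tridiagonal_mat :: "nat \<Rightarrow> (nat \<Rightarrow> nat \<Rightarrow> 'k::field) \<Rightarrow> bool" where
  "irred_tridiagonal_mat d B \<longleftrightarrow>
     (\<forall>i\<le>d. \<forall>j\<le>d. i + 1 < j \<or> j + 1 < i \<longrightarrow> B i j = 0) \<and>
     (\<forall>i<d. B i (i + 1) \<noteq> 0 \<and> B (i + 1) i \<noteq> 0)"

definition bipartite_mat :: "nat \<Rightarrow> (nat \<Rightarrow> nat \<Rightarrow> 'k::field) \<Rightarrow> bool" where
  "bipartite_mat d B \<longleftrightarrow> (\<forall>i\<le>d. B i i = 0)"

definition almost_bipartite_mat :: "nat \<Rightarrow> (nat \<Rightarrow> nat \<Rightarrow> 'k::field) \<Rightarrow> bool" where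
  "almost_bipartite_mat d B \<longleftrightarrow>
     (B 0 0 \<noteq> 0) \<noteq> (B d d \<noteq> 0) \<and> (\<forall>i. 1 \<le> i \<and> i < d \<longrightarrow> B i i = 0)"

text \<open>\<open>matrix_wrt scale d v T i j\<close> is the coefficient of \<open>v i\<close> in \<open>T (v j)\<close>.\<close>

definition matrix_wrt ::
    "('k::field \<Rightarrow> 'v::ab_group_add \<Rightarrow> 'v) \<Rightarrow>
      nat \<Rightarrow> (nat \<Rightarrow> 'v) \<Rightarrow> ('v \<Rightarrow> 'v) \<Rightarrow> nat \<Rightarrow> nat \<Rightarrow> 'k" where
  "matrix_wrt scale d v T i j = module.representation scale (v ` {..d}) (T (v j)) (v i)"

definition diam ::
    "('k::field \<Rightarrow> 'v::ab_group_add \<Rightarrow> 'v) \<Rightarrow>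
      nat" where
  "diam scale = vector_space.dim scale (UNIV :: 'v set) - 1"

text \<open>The basis required in (1) of the definition of a Leonard pair \<open>A, As\<close>; the basis required
  in (2) is obtained by exchanging \<open>A\<close> and \<open>As\<close>.\<close>

definition standard_basis ::
    "('k::field \<Rightarrow> 'v::ab_group_add \<Rightarrow> 'v) \<Rightarrow>
      ('v \<Rightarrow> 'v) \<Rightarrow> ('v \<Rightarrow> 'v) \<Rightarrow> (nat \<Rightarrow> 'v) \<Rightarrow> bool" where
  "standard_basis scale A As v \<longleftrightarrow>
     indexed_basis scale (diam scale) v \<and>
     diagonal_mat (diam scale) (matrix_wrt scale (diam scale) v A) \<and>
     irred_tridiagonal_mat (diam scale) (matrix_wrt scale (diam scale) v As)"

definition leonard_pair ::
    "('k::field \<Rightarrow> 'v::ab_group_add \<Rightarrow> 'v) \<Rightarrow>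
      ('v \<Rightarrow> 'v) \<Rightarrow> ('v \<Rightarrow> 'v) \<Rightarrow> bool" where
  "leonard_pair scale A As \<longleftrightarrow>
     Vector_Spaces.linear scale scale A \<and> Vector_Spaces.linear scale scale As \<and>
     (\<exists>v. standard_basis scale A As v) \<and> (\<exists>vs. standard_basis scale As A vs)"

text \<open>A basis as in (1) or (2) is unique up to reversing its order and rescaling its vectors.
  The three properties below do not depend on that choice, so it does not matter that they ask
  for some pair of bases rather than for every pair.\<close>

definition totally_bipartite ::
    "('k::field \<Rightarrow> 'v::ab_group_add \<Rightarrow> 'v) \<Rightarrow>
      ('v \<Rightarrow> 'v) \<Rightarrow> ('v \<Rightarrow> 'v) \<Rightarrow> bool" where
  "totally_bipartite scale A As \<longleftrightarrow> leonard_pair scale A As \<and>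
     (\<exists>v vs. standard_basis scale A As v \<and> standard_basis scale As A vs \<and>
        bipartite_mat (diam scale) (matrix_wrt scale (diam scale) v As) \<and>
        bipartite_mat (diam scale) (matrix_wrt scale (diam scale) vs A))"

definition totally_almost_bipartite ::
    "('k::field \<Rightarrow> 'v::ab_group_add \<Rightarrow> 'v) \<Rightarrow>
      ('v \<Rightarrow> 'v) \<Rightarrow> ('v \<Rightarrow> 'v) \<Rightarrow> bool" where
  "totally_almost_bipartite scale A As \<longleftrightarrow> leonard_pair scale A As \<and>
     (\<exists>v vs. standard_basis scale A As v \<and> standard_basis scale As A vs \<and>
        almost_bipartite_mat (diam scale) (matrix_wrt scale (diam scale) v As) \<and>
        almost_bipartite_mat (diam scale) (matrix_wrt scale (diam scale) vs A))"

text \<open>The eigenvalue of \<open>A\<close> for \<open>v i\<close> is the \<open>i\<close>-th diagonal entry of its matrix. For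
  \<open>diam scale < 3\<close> there is no index \<open>i\<close> below and hence no condition.\<close>

definition bannai_ito_type ::
    "('k::field \<Rightarrow> 'v::ab_group_add \<Rightarrow> 'v) \<Rightarrow>
      ('v \<Rightarrow> 'v) \<Rightarrow> ('v \<Rightarrow> 'v) \<Rightarrow> bool" where
  "bannai_ito_type scale A As \<longleftrightarrow> leonard_pair scale A As \<and>
     (\<exists>v vs. standard_basis scale A As v \<and> standard_basis scale As A vs \<and>
        (let \<theta> = (\<lambda>i. matrix_wrt scale (diam scale) v A i i);
             \<theta>s = (\<lambda>i. matrix_wrt scale (diam scale) vs As i i)
         in \<forall>i. 2 \<le> i \<and> i \<le> diam scale - 1 \<longrightarrow>
              (\<theta> (i - 2) - \<theta> (i + 1)) / (\<theta> (i - 1) - \<theta> i) = - 1 \<and>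
              (\<theta>s (i - 2) - \<theta>s (i + 1)) / (\<theta>s (i - 1) - \<theta>s i) = - 1))"

text \<open>All triples of nonzero scalars \<open>\<xi>\<close>, \<open>\<xi>s\<close> and an irreducible module structure for
  which \<open>A\<close>, \<open>As\<close> act as \<open>\<xi> x\<close>, \<open>\<xi>s y\<close>.\<close>

definition realizations ::
    "('k::field \<Rightarrow> 'v::ab_group_add \<Rightarrow> 'v) \<Rightarrow>
      ('v \<Rightarrow> 'v) \<Rightarrow> ('v \<Rightarrow> 'v) \<Rightarrow> ('k \<times> 'k \<times> ('k bi_alg \<Rightarrow> 'v \<Rightarrow> 'v)) set" where
  "realizations scale A As =
     {(\<xi>, \<xi>s, act). \<xi> \<noteq> 0 \<and> \<xi>s \<noteq> 0 \<and> irreducible_module scale act \<and>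
        (\<forall>v. A v = act (smult_alg \<xi> (alg_gen Gx)) v) \<and>
        (\<forall>v. As v = act (smult_alg \<xi>s (alg_gen Gy)) v)}"

end

theory Submission
  imports Defs
begin

text \<open>In the \<open>A\<close>-eigenbasis, after reversing it if necessary, \<open>A\<^sup>*\<close> is tridiagonal with diagonal entries
  vanishing except possibly the last one, and likewise with \<open>A\<close> and \<open>A\<^sup>*\<close> exchanged. The Bannai/Ito
  condition says that the sums \<open>\<theta>\<^sub>i + \<theta>\<^sub>i\<^sub>+\<^sub>1\<close> take alternately two values, which gives an Askey--Wilson
  relation \<open>{A, {A, A\<^sup>*}} - \<gamma> {A, A\<^sup>*} - \<rho> A\<^sup>* = 0\<close>, where \<open>{_, _}\<close> is the anticommutator. The vanishing
  diagonals force \<open>\<gamma> = 0\<close>, so the two values are \<open>s\<close> and \<open>-s\<close>, and \<open>\<rho> = s\<^sup>2\<close>. With \<open>z\<close> half the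
  anticommutator of \<open>x\<close> and \<open>y\<close>, the two remaining relations of \<open>\<A>\<close> read \<open>{x, {x, y}} = 4 y\<close> and
  \<open>{y, {y, x}} = 4 x\<close>; hence \<open>x = A / \<xi>\<close>, \<open>y = A\<^sup>* / \<xi>\<^sup>*\<close> define a module iff \<open>(2 \<xi>)\<^sup>2 = s\<^sup>2\<close> and
  \<open>(2 \<xi>\<^sup>*)\<^sup>2 = s\<^sup>*\<^sup>2\<close>. Finally, the diagonal entries of the second relation in the eigenbasis of \<open>A\<close>
  determine all eigenvalues and the products of opposite off-diagonal entries, so a rescaling of the
  basis yields the formulas of type \<open>B\<close> or \<open>AB\<close>.\<close>

section \<open>Modules from operators on the generators\<close>

lemma poly_mapping_single_add_induct [case_names zero add]:
  fixes p :: "'a \<Rightarrow>\<^sub>0 'b::monoid_add"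
  assumes "P 0"
    and "\<And>w c q. P q \<Longrightarrow> P (Poly_Mapping.single w c + q)"
  shows "P p"
proof (induction p rule: update_induct)
  case const
  show ?case by (rule assms(1))
next
  case (update f a b)
  have "Poly_Mapping.update a b f = Poly_Mapping.single a b + f"
    using update(1)
    by (intro poly_mapping_eqI)
      (auto simp: lookup_update lookup_add lookup_single when_def in_keys_iff)
  then show ?case using assms(2) update(3) by simp
qed

lemma linear_map_add: "Vector_Spaces.linear s s f \<Longrightarrow> f (u + v) = f u + f v"
  and linear_map_diff: "Vector_Spaces.linear s s f \<Longrightarrow> f (u - v) = f u - f v"
  and linear_map_scale: "Vector_Spaces.linear s s f \<Longrightarrow> f (s c u) = s c (f u)"
  and linear_map_zero: "Vector_Spaces.linear s s f \<Longrightarrow> f 0 = 0"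
  by (auto simp: Vector_Spaces.linear_def
      intro: module_hom.add module_hom.diff module_hom.scale module_hom.zero)

context vector_space
begin

lemma linear_mapI:
  assumes "\<And>u w. f (u + w) = f u + f w" and "\<And>c u. f (scale c u) = scale c (f u)"
  shows "Vector_Spaces.linear scale scale f"
  using assms by (simp add: Vector_Spaces.linear_iff vector_space_axioms)

lemma scale_two: "scale 2 u = u + u"
  using scale_left_distrib[of 1 1 u] by simp

end

text \<open>Serves in both directions: for operators built from \<open>A\<close> and
  \<open>As\<close>, and for the generators of a given module.\<close>

locale generator_operators = vector_space scale
  for scale :: "'k::field \<Rightarrow> 'v::ab_group_add \<Rightarrow> 'v" +
  fixes T :: "gen \<Rightarrow> 'v \<Rightarrow> 'v"
  assumes linear_T: "Vector_Spaces.linear scale scale (T g)"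
    and T_xy: "T Gx (T Gy u) + T Gy (T Gx u) = scale 2 (T Gz u)"
    and T_yz: "T Gy (T Gz u) + T Gz (T Gy u) = scale 2 (T Gx u)"
    and T_zx: "T Gz (T Gx u) + T Gx (T Gz u) = scale 2 (T Gy u)"
begin

definition free_act :: "'k free_alg \<Rightarrow> 'v \<Rightarrow> 'v" where
  "free_act p u = (\<Sum>w\<in>Poly_Mapping.keys p. scale (Poly_Mapping.lookup p w) (foldr T (letters w) u))"

lemma linear_foldr_T: "Vector_Spaces.linear scale scale (foldr T gs)"
proof (induction gs)
  case Nil
  show ?case by (rule linear_mapI) auto
next
  case (Cons g gs)
  then show ?case
    by (intro linear_mapI)
      (simp_all add: linear_map_add[OF linear_T] linear_map_scale[OF linear_T]
        linear_map_add linear_map_scale)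
qed

lemma free_act_zero [simp]: "free_act 0 u = 0"
  by (simp add: free_act_def)

lemma free_act_add: "free_act (p + q) u = free_act p u + free_act q u"
  unfolding free_act_def
  using setsum_keys_plus_distrib[of "\<lambda>w c. scale c (foldr T (letters w) u)" p q]
  by (simp add: scale_left_distrib)

lemma free_act_single:
  "free_act (Poly_Mapping.single w c) u = scale c (foldr T (letters w) u)"
  by (cases "c = 0") (simp_all add: free_act_def)

lemma linear_free_act: "Vector_Spaces.linear scale scale (free_act p)"
proof (induction p rule: poly_mapping_single_add_induct)
  case zero
  show ?case by (rule linear_mapI) auto
next
  case (add w c q)
  then show ?case
    by (intro linear_mapI)
      (simp_all add: free_act_add free_act_single linear_map_add linear_map_scale
        linear_map_add[OF linear_foldr_T] linear_map_scale[OF linear_foldr_T]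
        scale_right_distrib mult.commute)
qed

lemma free_act_mult: "free_act (p * q) u = free_act p (free_act q u)"
proof (induction p rule: poly_mapping_single_add_induct)
  case zero
  show ?case by simp
next
  case (add w c p)
  have "free_act (Poly_Mapping.single w c * q) u
      = scale c (foldr T (letters w) (free_act q u))"
  proof (induction q rule: poly_mapping_single_add_induct)
    case zero
    show ?case by (simp add: linear_map_zero[OF linear_foldr_T])
  next
    case (add w' c' q)
    then show ?case
      by (simp add: distrib_left mult_single free_act_add free_act_single plus_gword_def
          linear_map_add[OF linear_foldr_T] linear_map_scale[OF linear_foldr_T]
          scale_right_distrib)
  qed
  with add show ?case
    by (simp add: distrib_right free_act_add free_act_single)
qed

lemma free_act_one: "free_act 1 u = u"
  using free_act_single[of 0 1 u] by (simp add: zero_gword_def flip: single_one)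

lemma free_act_gen: "free_act (free_gen g) u = T g u"
  by (simp add: free_gen_def free_act_single)

lemma free_act_diff: "free_act (p - q) u = free_act p u - free_act q u"
  using free_act_add[of "p - q" q u] by simp

text \<open>As \<open>free_act\<close> is multiplicative, the polynomials acting as zero form a
  two-sided ideal, and it contains the three relators. The \<open>right\<close> case needs the
  hypothesis at another vector, hence \<open>arbitrary: u\<close>.\<close>

lemma free_act_relation_ideal: "p \<in> relation_ideal \<Longrightarrow> free_act p u = 0"
proof (induction arbitrary: u rule: relation_ideal.induct)
qed (simp_all add: free_act_add free_act_diff free_act_mult free_act_gen mult_2
    linear_map_zero[OF linear_free_act] T_xy T_yz T_zx scale_two)

definition alg_act :: "'k bi_alg \<Rightarrow> 'v \<Rightarrow> 'v" where
  "alg_act a = free_act (rep_bi_alg a)"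

lemma alg_act_abs: "alg_act (abs_bi_alg p) u = free_act p u"
proof -
  have "ideal_cong (rep_bi_alg (abs_bi_alg p)) p"
    by (rule Quotient3_rep_abs[OF Quotient3_bi_alg])
      (rule equivp_reflp[OF equivp_ideal_cong])
  then show ?thesis
    using free_act_relation_ideal free_act_diff
    by (metis alg_act_def eq_iff_diff_eq_0 ideal_cong_def)
qed

lemma alg_act_gen: "alg_act (alg_gen g) u = T g u"
  by (simp add: alg_gen_def alg_act_abs free_act_gen)

lemma alg_module_alg_act: "alg_module scale alg_act"
  unfolding alg_module_def
proof (intro conjI allI)
  show "Vector_Spaces.linear scale scale (alg_act a)" for a
    by (simp add: alg_act_def linear_free_act)
  show "alg_act (a + b) u = alg_act a u + alg_act b u" for a b u
    by (induct a rule: bi_alg.abs_induct; induct b rule: bi_alg.abs_induct) (simp add: alg_act_abs plus_bi_alg.abs_eq free_act_add)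
  show "alg_act (smult_alg c a) u = scale c (alg_act a u)" for c a u
    by (induct a rule: bi_alg.abs_induct)
      (simp add: alg_act_abs smult_alg_def times_bi_alg.abs_eq free_act_mult free_act_single
        zero_gword_def)
  show "alg_act (a * b) u = alg_act a (alg_act b u)" for a b u
    by (induct a rule: bi_alg.abs_induct; induct b rule: bi_alg.abs_induct) (simp add: alg_act_abs times_bi_alg.abs_eq free_act_mult)
  show "alg_act 1 u = u" for u
    by (simp add: one_bi_alg_def alg_act_abs free_act_one)
qed

end

text \<open>Words in the generators span the algebra: agreement passes from generators to words by
  induction on the length, then to linear combinations.\<close>

lemma alg_module_eqI:
  fixes act act' :: "'k::field bi_alg \<Rightarrow> 'v::ab_group_add \<Rightarrow> 'v"
  assumes "alg_module scale act" "alg_module scale act'"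
    and gen: "\<And>g u. act (alg_gen g) u = act' (alg_gen g) u"
  shows "act = act'"
proof -
  note act_add = assms(1,2)[unfolded alg_module_def, THEN conjunct2, THEN conjunct1, rule_format]
  note smult = assms(1,2)[unfolded alg_module_def, THEN conjunct2, THEN conjunct2, THEN conjunct1,
      rule_format]
  note mult = assms(1,2)[unfolded alg_module_def, THEN conjunct2, THEN conjunct2, THEN conjunct2,
      THEN conjunct1, rule_format]
  note one = assms(1,2)[unfolded alg_module_def, THEN conjunct2, THEN conjunct2, THEN conjunct2,
      THEN conjunct2, rule_format]
  have word: "act (abs_bi_alg (Poly_Mapping.single (Word gs) 1)) u
      = act' (abs_bi_alg (Poly_Mapping.single (Word gs) 1)) u" for gs u
  proof (induction gs arbitrary: u)
    case Nil
    have "abs_bi_alg (Poly_Mapping.single (Word []) 1) = (1 :: 'k bi_alg)"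
      by (simp add: one_bi_alg_def flip: zero_gword_def)
    then show ?case by (simp add: one)
  next
    case (Cons g gs)
    have "abs_bi_alg (Poly_Mapping.single (Word (g # gs)) 1)
        = (alg_gen g * abs_bi_alg (Poly_Mapping.single (Word gs) 1) :: 'k bi_alg)"
      by (simp add: alg_gen_def free_gen_def times_bi_alg.abs_eq mult_single plus_gword_def)
    with Cons show ?case by (simp add: mult gen)
  qed
  have "act (abs_bi_alg p) u = act' (abs_bi_alg p) u" for p u
  proof (induction p rule: poly_mapping_single_add_induct)
    case zero
    have "act 0 u = 0" "act' 0 u = 0"
      using act_add(1)[of 0 0 u] act_add(2)[of 0 0 u] by simp_all
    then show ?case by (simp flip: zero_bi_alg_def)
  next
    case (add w c q)
    have "abs_bi_alg (Poly_Mapping.single w c + q)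
        = smult_alg c (abs_bi_alg (Poly_Mapping.single w 1)) + abs_bi_alg q"
      by (simp add: smult_alg_def times_bi_alg.abs_eq plus_bi_alg.abs_eq mult_single)
    with add show ?case
      using word[of "letters w" u] by (simp only: act_add smult) simp
  qed
  then have "act a u = act' a u" for a u
    by (induct a rule: bi_alg.abs_induct)
  then show ?thesis by blast
qed

section \<open>Bases in which one operator is diagonal and the other irreducible tridiagonal\<close>

text \<open>Integer indices with zero padding avoid boundary cases: the vectors \<open>v i\<close>
  and the coordinate functionals \<open>k i\<close> vanish outside \<open>{0..int d}\<close>. The
  coefficients \<open>b i\<close> and \<open>c i\<close> are those with which \<open>As\<close>
  raises and lowers \<open>v i\<close>.\<close>

locale tridiagonal_basis = vector_space scale
  for scale :: "'k::field_char_0 \<Rightarrow> 'v::ab_group_add \<Rightarrow> 'v" +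
  fixes d :: nat
    and A As :: "'v \<Rightarrow> 'v"
    and v :: "int \<Rightarrow> 'v"
    and k :: "int \<Rightarrow> 'v \<Rightarrow> 'k"
    and \<theta> a b c :: "int \<Rightarrow> 'k"
  assumes linear_A: "Vector_Spaces.linear scale scale A"
    and linear_As: "Vector_Spaces.linear scale scale As"
    and k_add [simp]: "k i (u + w) = k i u + k i w"
    and k_scale [simp]: "k i (scale r u) = r * k i u"
    and k_v: "k i (v j) = (if i = j \<and> i \<in> {0..int d} then 1 else 0)"
    and expansion: "u = (\<Sum>i\<in>{0..int d}. scale (k i u) (v i))"
    and A_v: "A (v i) = scale (\<theta> i) (v i)"
    and As_v: "As (v i) = scale (c i) (v (i - 1)) + scale (a i) (v i) + scale (b i) (v (i + 1))"
    and a_outside: "i \<notin> {0..int d} \<Longrightarrow> a i = 0"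
    and b_eq_0_iff: "b i = 0 \<longleftrightarrow> i \<notin> {0..<int d}"
    and c_eq_0_iff: "c i = 0 \<longleftrightarrow> i \<notin> {1..int d}"
begin

lemma k_zero [simp]: "k i 0 = 0"
  using k_add[of i 0 0] by simp

lemma k_sum: "k i (sum f I) = (\<Sum>j\<in>I. k i (f j))"
  by (induction I rule: infinite_finite_induct) auto

lemma k_diff [simp]: "k i (u - w) = k i u - k i w"
  using k_add[of i "u - w" w] by simp

lemma k_outside: "i \<notin> {0..int d} \<Longrightarrow> k i u = 0"
  by (subst expansion) (auto simp: k_sum k_v)

lemma eqI: "(\<And>i. k i u = k i w) \<Longrightarrow> u = w"
  using expansion[of u] expansion[of w] by simp

lemma v_outside: "i \<notin> {0..int d} \<Longrightarrow> v i = 0"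
  by (rule eqI) (auto simp: k_v)

lemma v_nonzero: "i \<in> {0..int d} \<Longrightarrow> v i \<noteq> 0"
  using k_v[of i i] by auto

lemma linear_sum: "Vector_Spaces.linear scale scale f \<Longrightarrow> f (sum g I) = (\<Sum>i\<in>I. f (g i))"
  by (auto simp: Vector_Spaces.linear_def intro: module_hom.sum)

lemmas operator_simps = linear_map_add[OF linear_A] linear_map_scale[OF linear_A]
  linear_map_add[OF linear_As] linear_map_scale[OF linear_As]
  linear_sum[OF linear_A] linear_sum[OF linear_As]

lemma k_A: "k i (A u) = \<theta> i * k i u"
proof -
  have "k i (A u) = k i (A (\<Sum>j\<in>{0..int d}. scale (k j u) (v j)))"
    by (simp flip: expansion)
  also have "\<dots> = (\<Sum>j\<in>{0..int d}. k j u * (\<theta> j * k i (v j)))"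
    by (simp add: operator_simps A_v k_sum mult.assoc)
  also have "\<dots> = (\<Sum>j\<in>{0..int d}. if j = i then \<theta> i * k i u else 0)"
    by (intro sum.cong) (auto simp: k_v)
  also have "\<dots> = \<theta> i * k i u"
    using k_outside[of i u] by auto
  finally show ?thesis .
qed

text \<open>Reads \<open>As_v\<close> by rows instead of columns, so that entries of products of
  \<open>A\<close> and \<open>As\<close> can be computed by rewriting.\<close>

lemma k_As: "k i (As u) = b (i - 1) * k (i - 1) u + a i * k i u + c (i + 1) * k (i + 1) u"
proof (cases "i \<in> {0..int d}")
  case False
  then have "a i = 0" "b (i - 1) = 0 \<or> k (i - 1) u = 0" "c (i + 1) = 0 \<or> k (i + 1) u = 0"
    using a_outside b_eq_0_iff c_eq_0_iff k_outside[of _ u] by auto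
  then show ?thesis using k_outside[OF False] by auto
next
  case True
  have "k i (As u) = k i (As (\<Sum>j\<in>{0..int d}. scale (k j u) (v j)))"
    by (simp flip: expansion)
  also have "\<dots> = (\<Sum>j\<in>{0..int d}. k j u * k i (As (v j)))"
    by (simp add: operator_simps k_sum)
  also have "\<dots> = (\<Sum>j\<in>{0..int d}. (if j = i - 1 then b (i - 1) * k (i - 1) u else 0)
      + (if j = i then a i * k i u else 0) + (if j = i + 1 then c (i + 1) * k (i + 1) u else 0))"
    using True by (intro sum.cong) (auto simp: k_v As_v)
  also have "\<dots> = b (i - 1) * k (i - 1) u + a i * k i u + c (i + 1) * k (i + 1) u"
    using True k_outside[of "i - 1" u] k_outside[of "i + 1" u]
    by (auto simp: sum.distrib sum.delta)
  finally show ?thesis .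
qed

lemma reversed: "tridiagonal_basis scale d A As (\<lambda>i. v (int d - i)) (\<lambda>i. k (int d - i))
  (\<lambda>i. \<theta> (int d - i)) (\<lambda>i. a (int d - i)) (\<lambda>i. c (int d - i)) (\<lambda>i. b (int d - i))"
proof unfold_locales
  fix u
  have "u = (\<Sum>i\<in>{0..int d}. scale (k i u) (v i))" by (rule expansion)
  also have "\<dots> = (\<Sum>i\<in>{0..int d}. scale (k (int d - i) u) (v (int d - i)))"
    by (rule sum.reindex_bij_witness[of _ "\<lambda>i. int d - i" "\<lambda>i. int d - i"]) auto
  finally show "u = (\<Sum>i\<in>{0..int d}. scale (k (int d - i) u) (v (int d - i)))" .
next
  fix i
  have "int d - (i - 1) = (int d - i) + 1" "int d - (i + 1) = (int d - i) - 1" by simp_all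
  then show "As (v (int d - i)) = scale (b (int d - i)) (v (int d - (i - 1)))
      + scale (a (int d - i)) (v (int d - i)) + scale (c (int d - i)) (v (int d - (i + 1)))"
    by (simp only: As_v add_ac)
qed (auto simp: operator_simps k_v A_v a_outside b_eq_0_iff c_eq_0_iff)

lemma rescaled:
  assumes g: "\<And>i. g i \<noteq> 0"
  shows "tridiagonal_basis scale d A As (\<lambda>i. scale (g i) (v i)) (\<lambda>i u. k i u / g i) \<theta> a
    (\<lambda>i. b i * g i / g (i + 1)) (\<lambda>i. c i * g i / g (i - 1))"
  by unfold_locales
    (use g in \<open>auto simp: operator_simps k_v A_v As_v a_outside b_eq_0_iff c_eq_0_iff scale_right_distrib
      add_divide_distrib mult.commute simp flip: expansion\<close>)

text \<open>In coordinates the eigenvector equation is a three-term recurrence. Inside the range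
  \<open>c (i + 1)\<close> is nonzero, so each coordinate is determined by the two before
  it.\<close>

lemma eigenvector_As_eq_0_if_first:
  assumes "As u = scale \<mu> u" and "k 0 u = 0"
  shows "u = 0"
proof (rule eqI)
  have *: "k (int n) u = 0" for n
  proof (induction n rule: less_induct)
    case (less n)
    show ?case
    proof (cases n)
      case 0
      then show ?thesis using assms(2) by simp
    next
      case (Suc m)
      \<comment> \<open>For m = 0 the coordinate at -1 is meant, which lies outside the
        range.\<close>
      have "k (int m - 1) u = 0"
        using less[of "m - 1"] Suc k_outside[of "-1" u] by (cases m) auto
      moreover have "k (int m) u = 0" using less[of m] Suc by simp
      ultimately have "c (int m + 1) * k (int m + 1) u = 0"
        using k_As[of "int m" u] by (simp add: assms(1))
      then show ?thesis
        using k_outside[of "int n" u] Suc by (auto simp: c_eq_0_iff add.commute)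
    qed
  qed
  show "k i u = k i 0" for i
    using *[of "nat i"] k_outside[of i u] by (cases "i \<ge> 0") auto
qed

lemma eigenvector_As_eq_0_if_last:
  assumes "As u = scale \<mu> u" and "k (int d) u = 0"
  shows "u = 0"
  using tridiagonal_basis.eigenvector_As_eq_0_if_first[OF reversed assms(1)] assms(2) by simp

lemma indexed_basis: "indexed_basis scale d (\<lambda>i. v (int i))"
proof -
  have inj: "inj_on (\<lambda>i. v (int i)) {..d}"
  proof (rule inj_onI)
    fix i j assume *: "i \<in> {..d}" "j \<in> {..d}" "v (int i) = v (int j)"
    have "k (int i) (v (int i)) = 1" using *(1) by (simp add: k_v)
    with * show "i = j" by (auto simp: k_v split: if_splits)
  qed
  moreover have "independent ((\<lambda>i. v (int i)) ` {..d})"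
  proof (rule independent_if_scalars_zero)
    show "finite ((\<lambda>i. v (int i)) ` {..d})" by simp
    fix f x
    assume sum: "(\<Sum>x\<in>(\<lambda>i. v (int i)) ` {..d}. scale (f x) x) = 0"
      and "x \<in> (\<lambda>i. v (int i)) ` {..d}"
    then obtain i where i: "i \<le> d" "x = v (int i)" by auto
    have "(\<Sum>j\<le>d. scale (f (v (int j))) (v (int j))) = 0"
      using sum by (simp add: sum.reindex[OF inj])
    then have "(\<Sum>j\<le>d. f (v (int j)) * k (int i) (v (int j))) = 0"
      by (metis (no_types, lifting) k_scale k_sum k_zero sum.cong)
    moreover have "(\<Sum>j\<le>d. f (v (int j)) * k (int i) (v (int j)))
        = (\<Sum>j\<le>d. if j = i then f x else 0)"
      using i by (intro sum.cong) (auto simp: k_v)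
    ultimately show "f x = 0" using i by simp
  qed
  moreover have "u \<in> span ((\<lambda>i. v (int i)) ` {..d})" for u
  proof (subst expansion, intro span_sum span_scale span_base)
    fix i assume "i \<in> {0..int d}"
    then show "v i \<in> (\<lambda>i. v (int i)) ` {..d}"
      by (intro image_eqI[of _ _ "nat i"]) auto
  qed
  ultimately show ?thesis
    unfolding indexed_basis_def by auto
qed

text \<open>Induction on the number of nonzero coordinates: if a coordinate j other than i survives,
  applying \<open>A - \<theta> j\<close> removes it and multiplies the i-th one by a nonzero factor,
  as the eigenvalues are distinct.\<close>

lemma projection_in_subspace:
  assumes W: "subspace W" "\<And>u. u \<in> W \<Longrightarrow> A u \<in> W"
    and inj: "inj_on \<theta> {0..int d}" and "u \<in> W"
  shows "scale (k i u) (v i) \<in> W"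
  using \<open>u \<in> W\<close>
proof (induction "card {j \<in> {0..int d}. k j u \<noteq> 0}" arbitrary: u rule: less_induct)
  case less
  show ?case
  proof (cases "\<exists>j\<in>{0..int d}. j \<noteq> i \<and> k j u \<noteq> 0")
    case False
    have "scale (k i u) (v i) = u"
    proof (rule eqI)
      show "k j (scale (k i u) (v i)) = k j u" for j
        using False k_outside[of _ u] by (cases "j \<in> {0..int d}") (auto simp: k_v)
    qed
    then show ?thesis using less.prems by simp
  next
    case True
    then obtain j where j: "j \<in> {0..int d}" "j \<noteq> i" "k j u \<noteq> 0" by auto
    define u' where "u' = A u - scale (\<theta> j) u"
    have k_u': "k l u' = (\<theta> l - \<theta> j) * k l u" for l
      by (simp add: u'_def k_A algebra_simps)
    have "{l \<in> {0..int d}. k l u' \<noteq> 0} \<subset> {l \<in> {0..int d}. k l u \<noteq> 0}"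
      using j by (auto simp: k_u')
    then have "card {l \<in> {0..int d}. k l u' \<noteq> 0} < card {l \<in> {0..int d}. k l u \<noteq> 0}"
      by (rule psubset_card_mono[rotated]) (rule finite_subset[of _ "{0..int d}"], auto)
    moreover have "u' \<in> W"
      unfolding u'_def using W less.prems by (intro subspace_diff subspace_scale) auto
    ultimately have *: "scale (k i u') (v i) \<in> W" by (rule less.hyps)
    show ?thesis
    proof (cases "i \<in> {0..int d}")
      case True
      with j have "\<theta> i - \<theta> j \<noteq> 0" using inj by (auto dest: inj_onD)
      then have "scale (k i u) (v i) = scale (1 / (\<theta> i - \<theta> j)) (scale (k i u') (v i))"
        by (simp add: k_u')
      then show ?thesis using * W(1) by (simp only: subspace_scale)
    next
      case False
      then show ?thesis using W(1) by (simp add: k_outside subspace_0)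
    qed
  qed
qed

text \<open>A nonzero \<open>W\<close> contains some \<open>v i\<close> by projection. Applying
  \<open>As\<close> and projecting again reaches both neighbours, because \<open>b\<close> and
  \<open>c\<close> do not vanish inside the range, and so the whole basis.\<close>

lemma invariant_subspace_trivial:
  assumes W: "subspace W" "\<And>u. u \<in> W \<Longrightarrow> A u \<in> W" "\<And>u. u \<in> W \<Longrightarrow> As u \<in> W"
    and inj: "inj_on \<theta> {0..int d}"
  shows "W = {0} \<or> W = UNIV"
proof (cases "W \<subseteq> {0}")
  case True
  then show ?thesis using subspace_0[OF W(1)] by auto
next
  case False
  then obtain u where u: "u \<in> W" "u \<noteq> 0" by auto
  have v_in: "v i \<in> W" if "u \<in> W" "k i u \<noteq> 0" for i u
    using subspace_scale[OF W(1) projection_in_subspace[OF W(1,2) inj that(1), of i],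
      where c = "1 / k i u"] that(2)
    by simp
  from u obtain i where "k i u \<noteq> 0" using eqI[of u 0] by auto
  then have i: "v i \<in> W" "i \<in> {0..int d}" using v_in u k_outside by auto
  have up: "v (j + 1) \<in> W" if "v j \<in> W" "0 \<le> j" "j < int d" for j
    using that b_eq_0_iff[of j] W(3)[OF that(1)] by (intro v_in[of "As (v j)"]) (auto simp: k_v As_v)
  have down: "v (j - 1) \<in> W" if "v j \<in> W" "0 < j" "j \<le> int d" for j
    using that c_eq_0_iff[of j] W(3)[OF that(1)] by (intro v_in[of "As (v j)"]) (auto simp: k_v As_v)
  have "v j \<in> W" if "j \<in> {0..int d}" for j
  proof (cases "i \<le> j")
    case True
    then show ?thesis using that
    proof (induction j rule: int_ge_induct)
      case base
      then show ?case using i by simp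
    next
      case (step j)
      then show ?case using up[of j] i(2) by auto
    qed
  next
    case False
    then have "j \<le> i" by simp
    then show ?thesis using that
    proof (induction j rule: int_le_induct)
      case base
      then show ?case using i by simp
    next
      case (step j)
      then show ?case using down[of j] i(2) by auto
    qed
  qed
  then have "w \<in> W" for w
    by (subst expansion) (intro subspace_sum[OF W(1)] subspace_scale[OF W(1)])
  then show ?thesis by auto
qed

end

section \<open>The Askey--Wilson relation\<close>

text \<open>The Bannai/Ito condition with denominators cleared and the index shifted by two, so that
  it starts at 0.\<close>

definition adjacent_sums_alternate :: "nat \<Rightarrow> (int \<Rightarrow> 'k::field) \<Rightarrow> bool" where
  "adjacent_sums_alternate d \<theta> \<longleftrightarrow>
     (\<forall>i. 0 \<le> i \<and> i + 3 \<le> int d \<longrightarrow> \<theta> i + \<theta> (i + 1) = \<theta> (i + 2) + \<theta> (i + 3))"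

lemma adjacent_sums_alternate_reversed:
  assumes "adjacent_sums_alternate d \<theta>"
  shows "adjacent_sums_alternate d (\<lambda>i. \<theta> (int d - i))"
  unfolding adjacent_sums_alternate_def
proof (intro allI impI)
  fix i assume "0 \<le> i \<and> i + 3 \<le> int d"
  then have "0 \<le> int d - i - 3 \<and> int d - i - 3 + 3 \<le> int d" by simp
  with assms have "\<theta> (int d - i - 3) + \<theta> (int d - i - 3 + 1)
      = \<theta> (int d - i - 3 + 2) + \<theta> (int d - i - 3 + 3)"
    unfolding adjacent_sums_alternate_def by blast
  moreover have "int d - i - 3 = int d - (i + 3)" "int d - i - 3 + 1 = int d - (i + 2)"
    "int d - i - 3 + 2 = int d - (i + 1)" "int d - i - 3 + 3 = int d - i" by simp_all
  ultimately show "\<theta> (int d - i) + \<theta> (int d - (i + 1))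
      = \<theta> (int d - (i + 2)) + \<theta> (int d - (i + 3))"
    by (simp only: add.commute)
qed

text \<open>An injective walk with unit steps cannot turn back. Making d steps in one direction
  inside \<open>{0..int d}\<close>, it must start at an end.\<close>

lemma path_automorphism:
  fixes \<pi> :: "int \<Rightarrow> int"
  assumes inj: "inj_on \<pi> {0..int d}" and range: "\<And>i. i \<in> {0..int d} \<Longrightarrow> \<pi> i \<in> {0..int d}"
    and step: "\<And>i. 0 \<le> i \<Longrightarrow> i < int d \<Longrightarrow> \<bar>\<pi> (i + 1) - \<pi> i\<bar> = 1"
  shows "(\<forall>i\<in>{0..int d}. \<pi> i = i) \<or> (\<forall>i\<in>{0..int d}. \<pi> i = int d - i)"
proof (cases "d = 0")
  case True
  then show ?thesis using range[of 0] by auto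
next
  case False
  define e where "e = \<pi> 1 - \<pi> 0"
  have e: "\<bar>e\<bar> = 1" using step[of 0] False by (simp add: e_def)
  have *: "int n \<le> int d \<longrightarrow> \<pi> (int n) = \<pi> 0 + e * int n" for n
  proof (induction n rule: less_induct)
    case (less n)
    consider "n = 0" | "n = 1" | m where "n = Suc (Suc m)"
      by (metis One_nat_def not0_implies_Suc)
    then show ?case
    proof cases
      case 3
      show ?thesis
      proof
        assume "int n \<le> int d"
        moreover from this have "\<pi> (int m) = \<pi> 0 + e * int m" "\<pi> (int m + 1) = \<pi> 0 + e * (int m + 1)"
          using less[of m] less[of "Suc m"] 3 by (simp_all add: add.commute)
        moreover have "\<pi> (int m + 1 + 1) \<noteq> \<pi> (int m)"
          using inj_onD[OF inj, of "int m + 1 + 1" "int m"] 3 \<open>int n \<le> int d\<close> by auto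
        ultimately have "\<pi> (int m + 1 + 1) = \<pi> 0 + e * (int m + 1 + 1)"
          using step[of "int m + 1"] 3 e by (auto simp: abs_if algebra_simps split: if_splits)
        then show "\<pi> (int n) = \<pi> 0 + e * int n" using 3 by (simp add: algebra_simps)
      qed
    qed (auto simp: e_def)
  qed
  have "\<pi> (int d) = \<pi> 0 + e * int d" using * by simp
  moreover have "\<pi> 0 \<in> {0..int d}" "\<pi> (int d) \<in> {0..int d}" using range by auto
  ultimately consider "e = 1" "\<pi> 0 = 0" | "e = -1" "\<pi> 0 = int d"
    using e by (cases "e = 1") (auto simp: abs_if split: if_splits)
  moreover have "\<pi> i = \<pi> 0 + e * i" if "i \<in> {0..int d}" for i
    using *[of "nat i"] that by simp
  ultimately show ?thesis by cases simp_all
qed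

text \<open>Each \<open>w i\<close> is a multiple of a single \<open>v (\<pi> i)\<close>, and
  irreducibility of \<open>As\<close> makes \<open>\<pi>\<close> move by unit steps. This allows
  conditions known for different eigenbases to be combined.\<close>

lemma (in tridiagonal_basis) eigenvalues_unique_up_to_reversal:
  assumes "tridiagonal_basis scale d A As w l \<eta> p q r"
    and inj: "inj_on \<theta> {0..int d}" "inj_on \<eta> {0..int d}"
  shows "(\<forall>i\<in>{0..int d}. \<eta> i = \<theta> i) \<or> (\<forall>i\<in>{0..int d}. \<eta> i = \<theta> (int d - i))"
proof -
  interpret W: tridiagonal_basis scale d A As w l \<eta> p q r by fact
  have "\<exists>j\<in>{0..int d}. k j (w i) \<noteq> 0" if "i \<in> {0..int d}" for i
    using W.v_nonzero[OF that] eqI[of "w i" 0] k_outside by fastforce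
  then obtain \<pi> where \<pi>: "\<And>i. i \<in> {0..int d} \<Longrightarrow> \<pi> i \<in> {0..int d} \<and> k (\<pi> i) (w i) \<noteq> 0"
    by metis
  have eig: "\<eta> i = \<theta> j" if "k j (w i) \<noteq> 0" for i j
    using k_A[of j "w i"] that by (simp add: W.A_v)
  have only: "j = \<pi> i" if "k j (w i) \<noteq> 0" "i \<in> {0..int d}" for i j
    using eig[OF that(1)] eig[of "\<pi> i" i] \<pi>[OF that(2)] k_outside[of j] that(1) inj_onD[OF inj(1)]
    by metis
  have inj_\<pi>: "inj_on \<pi> {0..int d}"
    by (rule inj_onI) (metis \<pi> eig inj_onD[OF inj(2)])
  have "\<bar>\<pi> (i + 1) - \<pi> i\<bar> = 1" if i: "0 \<le> i" "i < int d" for i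
  proof -
    let ?j = "\<pi> (i + 1)"
    have j: "k ?j (w (i + 1)) \<noteq> 0" using \<pi>[of "i + 1"] i by auto
    have neq: "\<pi> (i + 1) \<noteq> \<pi> i"
      using inj_onD[OF inj_\<pi>, of "i + 1" i] i by auto
    have "k ?j (w i) = 0" using only[of ?j i] neq i by auto
    moreover have "k ?j (w (i - 1)) = 0"
    proof (cases "i = 0")
      case False
      then show ?thesis
        using only[of ?j "i - 1"] inj_onD[OF inj_\<pi>, of "i + 1" "i - 1"] i by auto
    qed (simp add: W.v_outside)
    \<comment> \<open>Of the three terms of \<open>As (w i)\<close> only the one along
      \<open>w (i + 1)\<close> has a coordinate at \<open>?j\<close>. By \<open>k_As\<close> it must
      come from a coordinate of \<open>w i\<close> next to \<open>?j\<close>.\<close>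
    ultimately have "k ?j (As (w i)) \<noteq> 0"
      using j i W.b_eq_0_iff[of i] by (simp add: W.As_v)
    then have "k (?j - 1) (w i) \<noteq> 0 \<or> k (?j + 1) (w i) \<noteq> 0"
      using \<open>k ?j (w i) = 0\<close> k_As[of ?j "w i"] by auto
    then show ?thesis using only[of "?j - 1" i] only[of "?j + 1" i] i by auto
  qed
  then have "(\<forall>i\<in>{0..int d}. \<pi> i = i) \<or> (\<forall>i\<in>{0..int d}. \<pi> i = int d - i)"
    using path_automorphism[OF inj_\<pi>] \<pi> by blast
  then show ?thesis using eig \<pi> by metis
qed

section \<open>Eigenbases of both operators\<close>

locale leonard_bases =
  D: tridiagonal_basis scale d A As v k \<theta> a b c +
  Ds: tridiagonal_basis scale d As A v' k' \<theta>' a' b' c'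
  for scale :: "'k::field_char_0 \<Rightarrow> 'v::ab_group_add \<Rightarrow> 'v"
    and d :: nat and A As :: "'v \<Rightarrow> 'v"
    and v v' :: "int \<Rightarrow> 'v" and k k' :: "int \<Rightarrow> 'v \<Rightarrow> 'k"
    and \<theta> \<theta>' a a' b b' c c' :: "int \<Rightarrow> 'k"
begin

lemma swapped: "leonard_bases scale d As A v' v k' k \<theta>' \<theta> a' a b' b c' c"
  by unfold_locales

text \<open>Two eigenvectors for the same eigenvalue would have a combination with zero first
  coordinate in \<open>v'\<close>, where \<open>A\<close> is irreducible tridiagonal; by the
  recurrence that combination vanishes.\<close>

lemma inj_eigenvalues: "inj_on \<theta> {0..int d}"
proof (rule inj_onI, rule ccontr)
  fix i j assume ij: "i \<in> {0..int d}" "j \<in> {0..int d}" "\<theta> i = \<theta> j" "i \<noteq> j"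
  define u where "u = scale (k' 0 (v j)) (v i) - scale (k' 0 (v i)) (v j)"
  have "A u = scale (\<theta> i) u"
    using ij(3) by (intro D.eqI) (simp add: D.k_A u_def D.k_v)
  moreover have "k' 0 u = 0" by (simp add: u_def mult.commute)
  ultimately have "u = 0" by (rule Ds.eigenvector_As_eq_0_if_first)
  then have "k i u = 0" by simp
  then have "k' 0 (v j) = 0" using ij by (simp add: u_def D.k_v)
  then have "v j = 0" using Ds.eigenvector_As_eq_0_if_first[OF D.A_v] by simp
  then show False using D.v_nonzero ij by simp
qed

end

text \<open>Both bases are oriented so that only the last diagonal entry may be nonzero. Leaving
  \<open>a (int d)\<close> open treats the bipartite and the almost bipartite case together.\<close>

locale bannai_ito_bases = leonard_bases +
  assumes diameter: "d \<ge> 3"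
    and BI: "adjacent_sums_alternate d \<theta>" and BI': "adjacent_sums_alternate d \<theta>'"
    and a_zero: "i < int d \<Longrightarrow> a i = 0" and a'_zero: "i < int d \<Longrightarrow> a' i = 0"
begin

lemma BI_swapped: "bannai_ito_bases scale d As A v' v k' k \<theta>' \<theta> a' a b' b c' c"
  using diameter BI BI' a_zero a'_zero
  by (intro bannai_ito_bases.intro swapped bannai_ito_bases_axioms.intro)

lemma adjacent_sum:
  assumes "0 \<le> i" "i < int d"
  shows "\<theta> i + \<theta> (i + 1) = (if even i then \<theta> 0 + \<theta> 1 else \<theta> 1 + \<theta> 2)"
proof -
  have "int n < int d \<longrightarrow>
      \<theta> (int n) + \<theta> (int n + 1) = (if even n then \<theta> 0 + \<theta> 1 else \<theta> 1 + \<theta> 2)" for n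
  proof (induction n rule: less_induct)
    case (less n)
    consider "n = 0" | "n = 1" | m where "n = Suc (Suc m)"
      by (metis One_nat_def not0_implies_Suc)
    then show ?case
    proof cases
      case 3
      show ?thesis
      proof
        assume "int n < int d"
        then have "\<theta> (int m) + \<theta> (int m + 1) = \<theta> (int m + 2) + \<theta> (int m + 3)"
          using BI 3 by (auto simp: adjacent_sums_alternate_def)
        moreover have n: "int n = int m + 2" using 3 by simp
        ultimately show "\<theta> (int n) + \<theta> (int n + 1) = (if even n then \<theta> 0 + \<theta> 1 else \<theta> 1 + \<theta> 2)"
          using less[of m] 3 \<open>int n < int d\<close> unfolding n by (simp add: 3 add.commute)
      qed
    qed auto
  qed
  from this[of "nat i"] show ?thesis using assms by (simp add: even_nat_iff)
qed

lemma eigenvalue_neq: "i \<in> {0..int d} \<Longrightarrow> j \<in> {0..int d} \<Longrightarrow> i \<noteq> j \<Longrightarrow> \<theta> i \<noteq> \<theta> j"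
  using inj_onD[OF inj_eigenvalues] by blast

text \<open>The Askey--Wilson relation of the pair with \<open>\<beta> = -2\<close>. In the basis \<open>v\<close> the left-hand side has
  only the corner entry at \<open>(d, d)\<close>, so it is a multiple of the projection onto \<open>v d\<close>. In the basis
  \<open>v'\<close> it is pentadiagonal, whereas that projection has a nonzero entry at \<open>(d, 0)\<close>.\<close>

lemma askey_wilson:
  defines "\<gamma> \<equiv> \<theta> 0 + 2 * \<theta> 1 + \<theta> 2" and "\<rho> \<equiv> - (\<theta> 0 + \<theta> 1) * (\<theta> 1 + \<theta> 2)"
  shows "A (A (As u)) + scale 2 (A (As (A u))) + As (A (A u))
      - scale \<gamma> (A (As u) + As (A u)) - scale \<rho> (As u) = 0" (is "?R u = 0")
    and "a (int d) \<noteq> 0 \<Longrightarrow> 2 * \<theta> (int d) = (if even d then \<theta> 0 + \<theta> 1 else \<theta> 1 + \<theta> 2)"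
proof -
  \<comment> \<open>The roots of \<open>f\<close> are the two values of the adjacent sums. The
    left-hand side multiplies the (i, j) entry of \<open>As\<close> by
    \<open>f (\<theta> i + \<theta> j)\<close>.\<close>
  define f where "f t = (t - (\<theta> 0 + \<theta> 1)) * (t - (\<theta> 1 + \<theta> 2))" for t
  have f_edge: "f (\<theta> i + \<theta> (i + 1)) = 0" if "0 \<le> i" "i < int d" for i
    using adjacent_sum[OF that] by (simp add: f_def)
  define \<kappa> where "\<kappa> = f (2 * \<theta> (int d)) * a (int d)"
  have "k j (?R u) = f (\<theta> (j - 1) + \<theta> j) * b (j - 1) * k (j - 1) u + f (2 * \<theta> j) * a j * k j u
      + f (\<theta> j + \<theta> (j + 1)) * c (j + 1) * k (j + 1) u" for j u
    by (simp add: D.k_A D.k_As f_def \<gamma>_def \<rho>_def algebra_simps)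
  moreover have "f (\<theta> (j - 1) + \<theta> j) * b (j - 1) = 0" for j
    using f_edge[of "j - 1"] D.b_eq_0_iff[of "j - 1"] by auto
  moreover have "f (\<theta> j + \<theta> (j + 1)) * c (j + 1) = 0" for j
    using f_edge[of j] D.c_eq_0_iff[of "j + 1"] by auto
  moreover have "f (2 * \<theta> j) * a j = (if j = int d then \<kappa> else 0)" for j
    using a_zero[of j] D.a_outside[of j] by (cases "j < int d") (auto simp: \<kappa>_def)
  ultimately have k_R: "k j (?R u) = (if j = int d then \<kappa> * k (int d) u else 0)" for j u
    by simp
  have R: "?R u = scale (\<kappa> * k (int d) u) (v (int d))" for u
    by (rule D.eqI, subst k_R) (auto simp: D.k_v)
  \<comment> \<open>Each term has at most two factors \<open>A\<close>, so \<open>v' 0\<close> is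
    moved at most to \<open>v' 2\<close>, and d is at least 3.\<close>
  have "k' (int d) (?R (v' 0)) = 0"
    using diameter by (auto simp: Ds.k_A Ds.k_As Ds.k_v Ds.A_v)
  then have "\<kappa> * k (int d) (v' 0) * k' (int d) (v (int d)) = 0"
    by (simp only: R Ds.k_scale)
  moreover have "k (int d) (v' 0) \<noteq> 0"
    using D.eigenvector_As_eq_0_if_last[OF Ds.A_v] Ds.v_nonzero[of 0] by auto
  moreover have "k' (int d) (v (int d)) \<noteq> 0"
    using Ds.eigenvector_As_eq_0_if_last[OF D.A_v] D.v_nonzero[of "int d"] by auto
  ultimately have "\<kappa> = 0" by simp
  then show "?R u = 0" by (subst R) simp
  assume "a (int d) \<noteq> 0"
  with \<open>\<kappa> = 0\<close> have "2 * \<theta> (int d) = \<theta> 0 + \<theta> 1 \<or> 2 * \<theta> (int d) = \<theta> 1 + \<theta> 2"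
    by (auto simp: \<kappa>_def f_def)
  moreover have "\<theta> (int d - 1) + \<theta> (int d) = (if even d then \<theta> 1 + \<theta> 2 else \<theta> 0 + \<theta> 1)"
    using adjacent_sum[of "int d - 1"] diameter by auto
  \<comment> \<open>Distinctness of the last two eigenvalues rules out the value of the last
    adjacent sum; what remains is the next value in the alternation.\<close>
  moreover have "\<theta> (int d - 1) + \<theta> (int d) \<noteq> 2 * \<theta> (int d)"
  proof
    assume "\<theta> (int d - 1) + \<theta> (int d) = 2 * \<theta> (int d)"
    then have "\<theta> (int d - 1) = \<theta> (int d)" by algebra
    then show False using eigenvalue_neq[of "int d - 1" "int d"] diameter by simp
  qed
  ultimately show "2 * \<theta> (int d) = (if even d then \<theta> 0 + \<theta> 1 else \<theta> 1 + \<theta> 2)"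
    by metis
qed

end

section \<open>Eigenvalues and off-diagonal products\<close>

context bannai_ito_bases
begin

text \<open>The coefficient \<open>\<gamma>\<close> vanishes because, off the corner, \<open>A\<close> has zero diagonal in the basis
  \<open>v'\<close>, so only the \<open>\<gamma>\<close> term of the Askey--Wilson relation contributes at distance one from the
  diagonal.\<close>

lemma adjacent_sums_opposite: "\<theta> 1 + \<theta> 2 = - (\<theta> 0 + \<theta> 1)"
proof (rule ccontr)
  define \<gamma> where "\<gamma> = \<theta> 0 + 2 * \<theta> 1 + \<theta> 2"
  define \<rho> where "\<rho> = - (\<theta> 0 + \<theta> 1) * (\<theta> 1 + \<theta> 2)"
  assume "\<not> ?thesis"
  then have "\<gamma> \<noteq> 0" unfolding \<gamma>_def by algebra
  \<comment> \<open>As d is at least 3, the indices 0, 1, 2 avoid the corner. The two equations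
    together give \<open>\<theta>' 0 = \<theta>' 2\<close>.\<close>
  have "\<theta>' i + \<theta>' (i + 1) = 0" if "i = 0 \<or> i = 1" for i
  proof -
    have "k' (i + 1) (A (A (As (v' i))) + scale 2 (A (As (A (v' i)))) + As (A (A (v' i)))
        - scale \<gamma> (A (As (v' i)) + As (A (v' i))) - scale \<rho> (As (v' i))) = 0"
      using askey_wilson(1)[of "v' i"] by (simp only: \<gamma>_def \<rho>_def Ds.k_zero)
    moreover have "a' i = 0" "a' (i + 1) = 0"
      using that diameter by (auto intro: a'_zero)
    ultimately have "\<gamma> * (\<theta>' i + \<theta>' (i + 1)) * b' i = 0"
      using that diameter by (auto simp: Ds.k_A Ds.k_As Ds.k_v Ds.A_v algebra_simps)
    moreover have "b' i \<noteq> 0" using that diameter by (auto simp: Ds.b_eq_0_iff)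
    ultimately show ?thesis using \<open>\<gamma> \<noteq> 0\<close> by simp
  qed
  from this[of 0] this[of 1] have "\<theta>' 0 + \<theta>' 1 = 0" "\<theta>' 1 + \<theta>' 2 = 0" by simp_all
  then have "\<theta>' 0 = \<theta>' 2" by algebra
  then show False
    using bannai_ito_bases.eigenvalue_neq[OF BI_swapped, of 0 2] diameter by simp
qed

definition s :: 'a where "s = \<theta> 0 + \<theta> 1"

definition s' :: 'a where "s' = \<theta>' 0 + \<theta>' 1"

lemma s_nonzero: "s \<noteq> 0"
proof
  assume "s = 0"
  then have "\<theta> 0 + \<theta> 1 = 0" "\<theta> 1 + \<theta> 2 = 0"
    using adjacent_sums_opposite by (simp_all add: s_def)
  then have "\<theta> 0 = \<theta> 2" by algebra
  then show False using eigenvalue_neq[of 0 2] diameter by simp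
qed

lemma adjacent_sum_sign:
  "n < d \<Longrightarrow> \<theta> (int n) + \<theta> (int n + 1) = (-1) ^ n * s"
  using adjacent_sum[of "int n"] adjacent_sums_opposite by (auto simp: s_def)

lemma eigenvalue_formula:
  assumes "i \<in> {0..int d}"
  shows "\<theta> i = (-1) powi i * (\<theta> 0 - s * of_int i)"
proof -
  have "int n \<le> int d \<longrightarrow> \<theta> (int n) = (-1) ^ n * (\<theta> 0 - s * of_nat n)" for n
  proof (induction n)
    case (Suc n)
    show ?case
    proof
      assume "int (Suc n) \<le> int d"
      then have "\<theta> (int n) + \<theta> (int n + 1) = (-1) ^ n * s"
        using adjacent_sum_sign[of n] by simp
      then have "\<theta> (int n + 1) = (-1) ^ n * s - \<theta> (int n)"
        by (simp add: eq_diff_eq add.commute)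
      also have "\<dots> = (-1) ^ Suc n * (\<theta> 0 - s * of_nat (Suc n))"
        using Suc \<open>int (Suc n) \<le> int d\<close> by (simp add: algebra_simps)
      finally show "\<theta> (int (Suc n)) = (-1) ^ Suc n * (\<theta> 0 - s * of_nat (Suc n))"
        by (simp add: add.commute)
    qed
  qed simp
  from this[of "nat i"] show ?thesis using assms by (simp add: power_int_def)
qed

text \<open>Opposite adjacent sums turn the Askey-Wilson coefficients into 0 and
  \<open>s\<^sup>2\<close>. This form can be compared with the module relation
  \<open>double_anticommutator_x\<close>.\<close>

lemma double_anticommutator:
  "A (A (As u)) + scale 2 (A (As (A u))) + As (A (A u)) = scale (s\<^sup>2) (As u)"
proof -
  have "\<theta> 0 + 2 * \<theta> 1 + \<theta> 2 = 0"
    using adjacent_sums_opposite by algebra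
  moreover have "- (\<theta> 0 + \<theta> 1) * (\<theta> 1 + \<theta> 2) = s\<^sup>2"
    unfolding adjacent_sums_opposite s_def by algebra
  ultimately show ?thesis
    using askey_wilson(1)[of u] by simp
qed

lemma s_swapped: "bannai_ito_bases.s \<theta>' = s'"
  by (simp add: s'_def bannai_ito_bases.s_def[OF BI_swapped])

lemma s'_nonzero: "s' \<noteq> 0"
  using bannai_ito_bases.s_nonzero[OF BI_swapped] by (simp add: s_swapped)

text \<open>The (i, i) entry, in the eigenbasis of \<open>A\<close>, of the relation with
  \<open>A\<close> and \<open>As\<close> exchanged.\<close>

lemma diagonal_relation:
  "2 * (\<theta> (i - 1) + \<theta> i) * (b (i - 1) * c i) + 2 * (\<theta> i + \<theta> (i + 1)) * (b i * c (i + 1))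
    + 4 * \<theta> i * (a i)\<^sup>2 = s'\<^sup>2 * \<theta> i" if "i \<in> {0..int d}"
proof -
  have "k i (As (As (A (v i))) + scale 2 (As (A (As (v i)))) + A (As (As (v i))))
      = k i (scale (s'\<^sup>2) (A (v i)))"
    using bannai_ito_bases.double_anticommutator[OF BI_swapped, of "v i"] by (simp only: s_swapped)
  then have "\<theta> i * (b (i - 1) * c i + a i * a i + c (i + 1) * b i)
      + 2 * (b (i - 1) * (\<theta> (i - 1) * c i) + a i * (\<theta> i * a i) + c (i + 1) * (\<theta> (i + 1) * b i))
      + \<theta> i * (b (i - 1) * c i + a i * a i + c (i + 1) * b i) = s'\<^sup>2 * \<theta> i"
    using that by (simp add: D.k_A D.k_As D.k_v D.A_v D.operator_simps)
  then show ?thesis by (simp add: algebra_simps power2_eq_square)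
qed

text \<open>Before the corner the diagonal entries vanish and the adjacent sums alternate in sign,
  so \<open>diagonal_relation\<close> prescribes the difference of consecutive products; the
  induction sums these differences.\<close>

lemma offdiagonal_product:
  assumes "i \<in> {0..int d}"
  shows "4 * s * (b (i - 1) * c i) = s'\<^sup>2 * of_int i * (2 * \<theta> 0 - s * of_int (i - 1))"
proof -
  have "int n \<le> int d \<longrightarrow> 4 * s * (b (int n - 1) * c (int n))
      = s'\<^sup>2 * of_nat n * (2 * \<theta> 0 - s * (of_nat n - 1))" for n
  proof (induction n)
    case 0
    then show ?case by (simp add: D.c_eq_0_iff)
  next
    case (Suc n)
    show ?case
    proof
      assume n: "int (Suc n) \<le> int d"
      define x where "x = b (int n - 1) * c (int n)"
      define y where "y = b (int n) * c (int n + 1)"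
      have t: "\<theta> (int n) = (-1) ^ n * (\<theta> 0 - s * of_nat n)"
        using eigenvalue_formula[of "int n"] n by simp
      have t1: "\<theta> (int n) + \<theta> (int n + 1) = (-1) ^ n * s"
        using adjacent_sum_sign[of n] n by simp
      \<comment> \<open>The factor \<open>x\<close> is kept because nothing is known about
        \<open>\<theta> (-1)\<close>; at n = 0 both sides vanish by \<open>c 0 = 0\<close>.\<close>
      have t2: "(\<theta> (int n - 1) + \<theta> (int n)) * x = - ((-1) ^ n * s * x)"
      proof (cases n)
        case 0
        moreover have "c 0 = 0" by (simp add: D.c_eq_0_iff)
        ultimately show ?thesis by (simp add: x_def)
      next
        case (Suc m)
        then have "\<theta> (int n - 1) + \<theta> (int n) = - ((-1) ^ n * s)"
          using adjacent_sum_sign[of m] n by (simp add: add.commute)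
        then show ?thesis by simp
      qed
      have "2 * ((\<theta> (int n - 1) + \<theta> (int n)) * x) + 2 * (\<theta> (int n) + \<theta> (int n + 1)) * y
          = s'\<^sup>2 * \<theta> (int n)"
        using diagonal_relation[of "int n"] n a_zero[of "int n"]
        by (simp add: x_def y_def algebra_simps)
      then have "(-1) ^ n * (2 * s * (y - x)) = (-1) ^ n * (s'\<^sup>2 * (\<theta> 0 - s * of_nat n))"
        unfolding t1 t2 unfolding t by (simp add: algebra_simps)
      then have "2 * s * (y - x) = s'\<^sup>2 * (\<theta> 0 - s * of_nat n)" by simp
      moreover have "4 * s * x = s'\<^sup>2 * of_nat n * (2 * \<theta> 0 - s * (of_nat n - 1))"
        using Suc n by (simp add: x_def)
      ultimately have "4 * s * y = s'\<^sup>2 * of_nat (Suc n) * (2 * \<theta> 0 - s * (of_nat (Suc n) - 1))"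
        unfolding of_nat_Suc by algebra
      then show "4 * s * (b (int (Suc n) - 1) * c (int (Suc n)))
          = s'\<^sup>2 * of_nat (Suc n) * (2 * \<theta> 0 - s * (of_nat (Suc n) - 1))"
        by (simp add: y_def add.commute)
    qed
  qed
  from this[of "nat i"] show ?thesis using assms by simp
qed

text \<open>\<open>diagonal_relation\<close> at d, where \<open>c (int d + 1) = 0\<close> removes
  one product, with the common sign \<open>(-1) ^ d\<close> cancelled.\<close>

lemma corner_relation:
  "4 * (\<theta> 0 - s * of_nat d) * (a (int d))\<^sup>2
    = s'\<^sup>2 * (\<theta> 0 - s * of_nat d) + 2 * s * (b (int d - 1) * c (int d))"
proof -
  define e :: 'a where "e = (-1) ^ d"
  have "\<theta> (int d) = e * (\<theta> 0 - s * of_nat d)"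
    using eigenvalue_formula[of "int d"] by (simp add: e_def)
  moreover have "\<theta> (int d - 1) + \<theta> (int d) = - (e * s)"
    using adjacent_sum_sign[of "d - 1"] diameter by (cases d) (simp_all add: e_def add.commute)
  moreover have "c (int d + 1) = 0" by (simp add: D.c_eq_0_iff)
  then have "2 * (\<theta> (int d - 1) + \<theta> (int d)) * (b (int d - 1) * c (int d))
      + 4 * \<theta> (int d) * (a (int d))\<^sup>2 = s'\<^sup>2 * \<theta> (int d)"
    using diagonal_relation[of "int d"] by simp
  ultimately have "e * (4 * (\<theta> 0 - s * of_nat d) * (a (int d))\<^sup>2)
      = e * (s'\<^sup>2 * (\<theta> 0 - s * of_nat d) + 2 * s * (b (int d - 1) * c (int d)))"
    by algebra
  then show ?thesis by (simp add: e_def)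
qed

text \<open>With a zero corner entry, \<open>corner_relation\<close> and
  \<open>offdiagonal_product\<close> both evaluate the last product, and comparing them fixes
  \<open>\<theta> 0\<close>. For odd d the first and last eigenvalues would then coincide.\<close>

lemma bipartite_parameters:
  assumes "a (int d) = 0"
  shows "2 * \<theta> 0 = s * of_nat d" and "even d"
    and "i \<in> {0..int d} \<Longrightarrow> 4 * (b (i - 1) * c i) = s'\<^sup>2 * of_int i * of_int (int d - i + 1)"
proof -
  have "4 * s * (b (int d - 1) * c (int d))
      = s'\<^sup>2 * of_nat d * (2 * \<theta> 0 - s * (of_nat d - 1))"
    using offdiagonal_product[of "int d"] by simp
  moreover have "0 = s'\<^sup>2 * (\<theta> 0 - s * of_nat d) + 2 * s * (b (int d - 1) * c (int d))"
    using corner_relation assms by simp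
  ultimately have "s'\<^sup>2 * (of_nat (Suc d) * (2 * \<theta> 0 - s * of_nat d)) = 0"
    unfolding of_nat_Suc by algebra
  then show *: "2 * \<theta> 0 = s * of_nat d"
    using s'_nonzero by (simp del: of_nat_Suc)
  show "even d"
  proof (rule ccontr)
    assume "odd d"
    then have "\<theta> (int d) = - (\<theta> 0 - s * of_nat d)"
      using eigenvalue_formula[of "int d"] by simp
    with * have "\<theta> (int d) = \<theta> 0" by algebra
    then show False using eigenvalue_neq[of "int d" 0] diameter by simp
  qed
  assume "i \<in> {0..int d}"
  then have "s * (4 * (b (i - 1) * c i)) = s * (s'\<^sup>2 * of_int i * of_int (int d - i + 1))"
    using offdiagonal_product[of i] * by simp algebra
  then show "4 * (b (i - 1) * c i) = s'\<^sup>2 * of_int i * of_int (int d - i + 1)"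
    using s_nonzero by simp
qed

text \<open>A nonzero corner entry gives the further equation \<open>askey_wilson(2)\<close>, which
  fixes \<open>\<theta> 0\<close>. The corner relation then fixes the square of the corner entry,
  leaving its sign open.\<close>

lemma almost_bipartite_parameters:
  assumes "a (int d) \<noteq> 0"
  shows "2 * \<theta> 0 = s * of_nat (2 * d + 1)"
    and "i \<in> {0..int d} \<Longrightarrow> 4 * (b (i - 1) * c i) = s'\<^sup>2 * of_int i * of_int (2 * int d - i + 2)"
    and "(2 * a (int d))\<^sup>2 = (s' * of_nat (d + 1))\<^sup>2"
proof -
  have "2 * \<theta> (int d) = (-1) ^ d * s"
    using askey_wilson(2)[OF assms] adjacent_sums_opposite by (auto simp: s_def)
  then have "(-1) ^ d * (2 * (\<theta> 0 - s * of_nat d)) = (-1) ^ d * s"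
    using eigenvalue_formula[of "int d"] by (simp add: mult_ac)
  then have **: "2 * (\<theta> 0 - s * of_nat d) = s" by simp
  then show *: "2 * \<theta> 0 = s * of_nat (2 * d + 1)" by (simp add: algebra_simps)
  show product: "4 * (b (i - 1) * c i) = s'\<^sup>2 * of_int i * of_int (2 * int d - i + 2)"
    if "i \<in> {0..int d}" for i
  proof -
    have "s * (4 * (b (i - 1) * c i)) = s * (s'\<^sup>2 * of_int i * of_int (2 * int d - i + 2))"
      using offdiagonal_product[OF that] * by simp algebra
    then show ?thesis using s_nonzero by simp
  qed
  have "4 * (b (int d - 1) * c (int d)) = s'\<^sup>2 * of_nat d * (of_nat d + 2)"
    using product[of "int d"] by (simp add: algebra_simps)
  then have "s * (2 * a (int d))\<^sup>2 = s * (s' * (of_nat d + 1))\<^sup>2"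
    using corner_relation ** by algebra
  then show "(2 * a (int d))\<^sup>2 = (s' * of_nat (d + 1))\<^sup>2" using s_nonzero by (simp add: add.commute)
qed

end

section \<open>Realizations\<close>

lemma minus_one_powi: "(-1 :: 'a::field) powi i = (if even i then 1 else -1)"
  by (auto simp: power_int_def minus_one_power_iff even_nat_iff)

text \<open>Rescaling the basis preserves the products \<open>b (i - 1) * c i\<close>, so any
  off-diagonal coefficients with these products can be attained. Used with \<open>N\<close> equal to
  d for type B and to 2 d + 1 for type AB.\<close>

lemma (in tridiagonal_basis) ladder_basis:
  assumes "\<eta> \<noteq> 0"
    and product: "\<And>i. i \<in> {1..int d} \<Longrightarrow> b (i - 1) * c i = \<eta>\<^sup>2 * of_int i * of_int (N - i + 1)"
  obtains u where "Defs.indexed_basis scale d (\<lambda>i. u (int i))"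
    and "\<And>i. i \<notin> {0..int d} \<Longrightarrow> u i = 0"
    and "\<And>i. A (u i) = scale (\<theta> i) (u i)"
    and "\<And>i. i \<in> {0..int d} \<Longrightarrow> As (u i) = scale (\<eta> * of_int (N - i + 1)) (u (i - 1))
      + scale (a i) (u i) + scale (\<eta> * of_int (i + 1)) (u (i + 1))"
proof -
  \<comment> \<open>The ratio of consecutive scaling factors that turns the raising coefficient into
    \<open>\<eta> * of_int (i + 1)\<close>. The value 1 from d on keeps every factor
    nonzero.\<close>
  define h where "h i = (if i < d then b (int i) / (\<eta> * (of_nat i + 1)) else 1)" for i
  define g where "g i = (\<Prod>j<nat i. h j)" for i
  have of_nat: "of_nat i + 1 \<noteq> (0 :: 'k)" for i
    using of_nat_neq_0[of i] by (simp add: add.commute)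
  have "h i \<noteq> 0" for i
    using of_nat[of i] \<open>\<eta> \<noteq> 0\<close> by (simp add: h_def b_eq_0_iff)
  then have g: "g i \<noteq> 0" for i by (simp add: g_def)
  have g_Suc: "g (i + 1) = g i * (b i / (\<eta> * of_int (i + 1)))" if i: "0 \<le> i" "i < int d" for i
  proof -
    have "nat (i + 1) = Suc (nat i)" using i by simp
    then show ?thesis using i by (auto simp: g_def h_def)
  qed
  interpret W: tridiagonal_basis scale d A As "\<lambda>i. scale (g i) (v i)" "\<lambda>i u. k i u / g i" \<theta> a
    "\<lambda>i. b i * g i / g (i + 1)" "\<lambda>i. c i * g i / g (i - 1)"
    by (rule rescaled) (rule g)
  show thesis
  proof (rule that[of "\<lambda>i. scale (g i) (v i)"])
    show "Defs.indexed_basis scale d (\<lambda>i. scale (g (int i)) (v (int i)))"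
      by (rule W.indexed_basis)
    show "scale (g i) (v i) = 0" if "i \<notin> {0..int d}" for i
      using v_outside[OF that] by simp
    show "A (scale (g i) (v i)) = scale (\<theta> i) (scale (g i) (v i))" for i
      by (rule W.A_v)
    show "As (scale (g i) (v i)) = scale (\<eta> * of_int (N - i + 1)) (scale (g (i - 1)) (v (i - 1)))
      + scale (a i) (scale (g i) (v i)) + scale (\<eta> * of_int (i + 1)) (scale (g (i + 1)) (v (i + 1)))"
      if i: "i \<in> {0..int d}" for i
    proof -
      have "scale (c i * g i / g (i - 1)) (scale (g (i - 1)) (v (i - 1)))
          = scale (\<eta> * of_int (N - i + 1)) (scale (g (i - 1)) (v (i - 1)))"
      proof (cases "i = 0")
        case False
        have "of_int i \<noteq> (0 :: 'k)" using False by simp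
        have "g i * (\<eta> * of_int i) = g (i - 1) * b (i - 1)"
          using g_Suc[of "i - 1"] False i \<open>of_int i \<noteq> (0 :: 'k)\<close> \<open>\<eta> \<noteq> 0\<close> by simp
        moreover have "b (i - 1) * c i = \<eta>\<^sup>2 * of_int i * of_int (N - i + 1)"
          using product[of i] False i by simp
        ultimately have "(\<eta> * of_int i) * (c i * g i)
            = (\<eta> * of_int i) * (\<eta> * of_int (N - i + 1) * g (i - 1))"
          by algebra
        then have "c i * g i / g (i - 1) = \<eta> * of_int (N - i + 1)"
          using g[of "i - 1"] \<open>of_int i \<noteq> (0 :: 'k)\<close> \<open>\<eta> \<noteq> 0\<close> by (simp add: nonzero_divide_eq_eq)
        then show ?thesis by simp
      qed (simp add: v_outside)
      moreover have "scale (b i * g i / g (i + 1)) (scale (g (i + 1)) (v (i + 1)))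
          = scale (\<eta> * of_int (i + 1)) (scale (g (i + 1)) (v (i + 1)))"
      proof (cases "i = int d")
        case False
        have "of_int (i + 1) \<noteq> (0 :: 'k)" using i by (simp only: of_int_eq_0_iff) simp
        then have "b i * g i / g (i + 1) = \<eta> * of_int (i + 1)"
          using g_Suc[of i] False i g[of i] g[of "i + 1"] \<open>\<eta> \<noteq> 0\<close>
          by (simp add: divide_simps mult_ac)
        then show ?thesis by simp
      qed (simp add: v_outside)
      ultimately show ?thesis by (subst W.As_v) (simp only:)
    qed
  qed
qed

section \<open>The defining relations as double anticommutators\<close>

context generator_operators
begin

lemma linear_T_simps:
  "T g (u + w) = T g u + T g w" "T g (u - w) = T g u - T g w" "T g (scale r u) = scale r (T g u)"
  using linear_T[of g] by (simp_all add: linear_map_add linear_map_diff linear_map_scale)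

text \<open>The inner anticommutator of x and y is 2 z, and that of x and z is 2 y, whence the
  factor 4.\<close>

lemma double_anticommutator_x:
  "T Gx (T Gx (T Gy u)) + scale 2 (T Gx (T Gy (T Gx u))) + T Gy (T Gx (T Gx u)) = scale 4 (T Gy u)"
proof -
  have "T Gx (T Gx (T Gy u)) + scale 2 (T Gx (T Gy (T Gx u))) + T Gy (T Gx (T Gx u))
      = T Gx (T Gx (T Gy u) + T Gy (T Gx u)) + (T Gx (T Gy (T Gx u)) + T Gy (T Gx (T Gx u)))"
    by (simp add: linear_T_simps scale_two)
  also have "\<dots> = scale 2 (T Gz (T Gx u) + T Gx (T Gz u))"
    by (simp add: T_xy linear_T_simps scale_right_distrib add.commute)
  finally show ?thesis by (simp add: T_zx)
qed

lemma double_anticommutator_y: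
  "T Gy (T Gy (T Gx u)) + scale 2 (T Gy (T Gx (T Gy u))) + T Gx (T Gy (T Gy u)) = scale 4 (T Gx u)"
proof -
  have "T Gy (T Gy (T Gx u)) + scale 2 (T Gy (T Gx (T Gy u))) + T Gx (T Gy (T Gy u))
      = T Gy (T Gx (T Gy u) + T Gy (T Gx u)) + (T Gx (T Gy (T Gy u)) + T Gy (T Gx (T Gy u)))"
    by (simp add: linear_T_simps scale_two)
  also have "\<dots> = scale 2 (T Gy (T Gz u) + T Gz (T Gy u))"
    by (simp add: T_xy linear_T_simps scale_right_distrib)
  finally show ?thesis by (simp add: T_yz)
qed

end

text \<open>The first relation forces z to be half the anticommutator of x and y; with this z, the
  other two relations are \<open>XY\<close> and \<open>YX\<close>.\<close>

lemma (in vector_space) generator_operatorsI: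
  fixes X Y :: "'b \<Rightarrow> 'b"
  assumes two: "(2 :: 'a) \<noteq> 0"
    and linear: "Vector_Spaces.linear scale scale X" "Vector_Spaces.linear scale scale Y"
    and XY: "\<And>u. X (X (Y u)) + scale 2 (X (Y (X u))) + Y (X (X u)) = scale 4 (Y u)"
    and YX: "\<And>u. Y (Y (X u)) + scale 2 (Y (X (Y u))) + X (Y (Y u)) = scale 4 (X u)"
  shows "generator_operators scale
    (\<lambda>g. case g of Gx \<Rightarrow> X | Gy \<Rightarrow> Y | Gz \<Rightarrow> (\<lambda>u. scale (1 / 2) (X (Y u) + Y (X u))))"
proof -
  note linear_simps = linear[THEN linear_map_add] linear[THEN linear_map_scale]
  have half: "u = w" if "scale 2 u = scale 2 w" for u w
    using that two by simp
  have four: "scale 4 w = w + (w + (w + w))" for w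
    using scale_left_distrib[of 2 2 w] by (simp add: scale_two add_ac)
  have "Y (scale (1 / 2) (X (Y u) + Y (X u))) + scale (1 / 2) (X (Y (Y u)) + Y (X (Y u)))
      = scale 2 (X u)" for u
    by (rule half) (use YX[of u] two in \<open>simp add: linear_simps scale_right_distrib scale_two four add_ac\<close>)
  moreover have "scale (1 / 2) (X (Y (X u)) + Y (X (X u))) + X (scale (1 / 2) (X (Y u) + Y (X u)))
      = scale 2 (Y u)" for u
    by (rule half) (use XY[of u] two in \<open>simp add: linear_simps scale_right_distrib scale_two four add_ac\<close>)
  moreover have "Vector_Spaces.linear scale scale (\<lambda>u. scale (1 / 2) (X (Y u) + Y (X u)))"
    by (rule linear_mapI) (simp_all add: linear_simps scale_right_distrib mult.commute add_ac)
  ultimately show ?thesis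
    by unfold_locales (use linear two in \<open>auto simp: linear_simps scale_right_distrib split: gen.splits\<close>)
qed

lemma (in vector_space) generator_operators_module:
  assumes "alg_module scale act"
  shows "generator_operators scale (\<lambda>g. act (alg_gen g))"
proof (intro generator_operators.intro generator_operators_axioms.intro vector_space_axioms)
  have mult: "act (p * q) u = act p (act q u)" and add: "act (p + q) u = act p u + act q u" for p q u
    using assms by (simp_all add: alg_module_def)
  note rel = arg_cong[OF alg_gen_relations(1), of act] arg_cong[OF alg_gen_relations(2), of act]
    arg_cong[OF alg_gen_relations(3), of act]
  fix u
  show "act (alg_gen Gx) (act (alg_gen Gy) u) + act (alg_gen Gy) (act (alg_gen Gx) u)
      = scale 2 (act (alg_gen Gz) u)"
    using fun_cong[OF rel(1), of u] by (simp add: mult_2 add mult scale_two)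
  show "act (alg_gen Gy) (act (alg_gen Gz) u) + act (alg_gen Gz) (act (alg_gen Gy) u)
      = scale 2 (act (alg_gen Gx) u)"
    using fun_cong[OF rel(2), of u] by (simp add: mult_2 add mult scale_two)
  show "act (alg_gen Gz) (act (alg_gen Gx) u) + act (alg_gen Gx) (act (alg_gen Gz) u)
      = scale 2 (act (alg_gen Gy) u)"
    using fun_cong[OF rel(3), of u] by (simp add: mult_2 add mult scale_two)
qed (use assms in \<open>simp add: alg_module_def\<close>)

lemma (in vector_space) realizations_iff:
  "(\<xi>, \<xi>s, act) \<in> realizations scale A As \<longleftrightarrow>
    \<xi> \<noteq> 0 \<and> \<xi>s \<noteq> 0 \<and> irreducible_module scale act \<and>
    (\<forall>u. act (alg_gen Gx) u = scale (1 / \<xi>) (A u)) \<and>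
    (\<forall>u. act (alg_gen Gy) u = scale (1 / \<xi>s) (As u))"
proof -
  have *: "(\<forall>u. S u = act (smult_alg r p) u) \<longleftrightarrow> (\<forall>u. act p u = scale (1 / r) (S u))"
    if "irreducible_module scale act" "r \<noteq> 0" for S r p
  proof -
    have "act (smult_alg r p) u = scale r (act p u)" for u
      using that by (simp add: irreducible_module_def alg_module_def)
    moreover have "S u = scale r (act p u) \<longleftrightarrow> act p u = scale (1 / r) (S u)" for u
      using that by auto
    ultimately show ?thesis by (simp only:)
  qed
  show ?thesis
    unfolding realizations_def mem_Collect_eq prod.case using * by metis
qed

section \<open>Scalars and module structures realizing the pair\<close>

context bannai_ito_bases
begin

lemma double_anticommutator_swapped:
  "As (As (A u)) + scale 2 (As (A (As u))) + A (As (As u)) = scale (s'\<^sup>2) (A u)"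
  using bannai_ito_bases.double_anticommutator[OF BI_swapped, of u] by (simp only: s_swapped)

text \<open>\<open>A\<close> maps \<open>v' 0\<close> to a vector with nonzero coordinate at
  \<open>v' 1\<close>. This permits comparing scalars when two multiples of \<open>A\<close>
  agree.\<close>

lemma A_nonzero: "\<exists>u. A u \<noteq> 0"
proof -
  have "k' 1 (A (v' 0)) \<noteq> 0"
    using diameter by (simp add: Ds.k_As Ds.k_v Ds.b_eq_0_iff)
  then show ?thesis by (metis Ds.k_zero)
qed

lemma realization_generators:
  assumes "(\<xi>, \<xi>s, act) \<in> realizations scale A As"
  shows "generator_operators scale (\<lambda>g. act (alg_gen g))"
    and "A u = scale \<xi> (act (alg_gen Gx) u)" and "As u = scale \<xi>s (act (alg_gen Gy) u)"
    and "act (alg_gen Gz) u = scale (1 / (2 * \<xi> * \<xi>s)) (A (As u) + As (A u))"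
proof -
  show T: "generator_operators scale (\<lambda>g. act (alg_gen g))"
    using assms by (intro D.generator_operators_module) (simp add: D.realizations_iff irreducible_module_def)
  interpret T: generator_operators scale "\<lambda>g. act (alg_gen g)" by fact
  have nonzero: "\<xi> \<noteq> 0" "\<xi>s \<noteq> 0" using assms by (simp_all add: D.realizations_iff)
  show A: "A u = scale \<xi> (act (alg_gen Gx) u)" and As: "As u = scale \<xi>s (act (alg_gen Gy) u)" for u
    using assms by (simp_all add: D.realizations_iff)
  have "A (As u) + As (A u) = scale (\<xi> * \<xi>s) (scale 2 (act (alg_gen Gz) u))"
    unfolding T.T_xy[symmetric] A As by (simp add: T.linear_T_simps D.scale_right_distrib mult.commute)
  then show "act (alg_gen Gz) u = scale (1 / (2 * \<xi> * \<xi>s)) (A (As u) + As (A u))"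
    using nonzero by simp
qed

text \<open>The double anticommutator is evaluated twice: the pair gives the factor
  \<open>s\<^sup>2\<close>, the module relations give \<open>(2 * \<xi>)\<^sup>2\<close>. Exchanging
  the operators handles \<open>\<xi>s\<close>.\<close>

lemma realization_scalars:
  assumes "(\<xi>, \<xi>s, act) \<in> realizations scale A As"
  shows "(2 * \<xi>)\<^sup>2 = s\<^sup>2" and "(2 * \<xi>s)\<^sup>2 = s'\<^sup>2"
proof -
  note gen = realization_generators[OF assms]
  interpret T: generator_operators scale "\<lambda>g. act (alg_gen g)" by (rule gen(1))
  let ?x = "act (alg_gen Gx)" and ?y = "act (alg_gen Gy)"
  have "A (A (As u)) + scale 2 (A (As (A u))) + As (A (A u))
      = scale (\<xi>\<^sup>2 * \<xi>s) (?x (?x (?y u)) + scale 2 (?x (?y (?x u))) + ?y (?x (?x u)))" for u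
    unfolding gen(2,3)
    by (simp add: T.linear_T_simps D.scale_right_distrib power2_eq_square mult_ac)
  also have "\<dots> u = scale ((2 * \<xi>)\<^sup>2) (As u)" for u
    unfolding T.double_anticommutator_x gen(3) by (simp add: power2_eq_square mult_ac)
  finally have "scale (s\<^sup>2) (As u) = scale ((2 * \<xi>)\<^sup>2) (As u)" for u
    by (simp add: double_anticommutator)
  then show "(2 * \<xi>)\<^sup>2 = s\<^sup>2"
    using bannai_ito_bases.A_nonzero[OF BI_swapped] by (metis D.scale_right_imp_eq)
  have "As (As (A u)) + scale 2 (As (A (As u))) + A (As (As u))
      = scale (\<xi>s\<^sup>2 * \<xi>) (?y (?y (?x u)) + scale 2 (?y (?x (?y u))) + ?x (?y (?y u)))" for u
    unfolding gen(2,3)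
    by (simp add: T.linear_T_simps D.scale_right_distrib power2_eq_square mult_ac)
  also have "\<dots> u = scale ((2 * \<xi>s)\<^sup>2) (A u)" for u
    unfolding T.double_anticommutator_y gen(2) by (simp add: power2_eq_square mult_ac)
  finally have "scale (s'\<^sup>2) (A u) = scale ((2 * \<xi>s)\<^sup>2) (A u)" for u
    by (simp add: double_anticommutator_swapped)
  then show "(2 * \<xi>s)\<^sup>2 = s'\<^sup>2"
    using A_nonzero by (metis D.scale_right_imp_eq)
qed

text \<open>The scalars determine the actions of x and y, and the first relation then determines
  z.\<close>

lemma realization_unique:
  assumes "(\<xi>, \<xi>s, act) \<in> realizations scale A As" "(\<xi>, \<xi>s, act') \<in> realizations scale A As"
  shows "act' = act"
proof (rule alg_module_eqI)
  show "alg_module scale act'" "alg_module scale act"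
    using assms by (simp_all add: D.realizations_iff irreducible_module_def)
  show "act' (alg_gen g) u = act (alg_gen g) u" for g u
    using assms realization_generators(4)[OF assms(1)] realization_generators(4)[OF assms(2)]
    by (cases g) (simp_all add: D.realizations_iff)
qed

text \<open>Dividing by the scalars turns the factors \<open>s\<^sup>2\<close> and
  \<open>s'\<^sup>2\<close> of the double anticommutators into the 4 of the module relations. A
  submodule is invariant under \<open>A\<close> and \<open>As\<close>, hence trivial.\<close>

lemma realization_exists:
  assumes \<xi>: "(2 * \<xi>)\<^sup>2 = s\<^sup>2" and \<xi>s: "(2 * \<xi>s)\<^sup>2 = s'\<^sup>2"
  shows "\<exists>act. (\<xi>, \<xi>s, act) \<in> realizations scale A As"
proof -
  have nonzero: "\<xi> \<noteq> 0" "\<xi>s \<noteq> 0" using assms s_nonzero s'_nonzero by auto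
  define X Y where "X = (\<lambda>u. scale (1 / \<xi>) (A u))" and "Y = (\<lambda>u. scale (1 / \<xi>s) (As u))"
  have linear: "Vector_Spaces.linear scale scale X" "Vector_Spaces.linear scale scale Y"
    unfolding X_def Y_def
    by (auto intro!: D.linear_mapI simp: D.operator_simps D.scale_right_distrib mult.commute)
  have "X (X (Y u)) + scale 2 (X (Y (X u))) + Y (X (X u)) = scale 4 (Y u)" for u
  proof -
    have "X (X (Y u)) + scale 2 (X (Y (X u))) + Y (X (X u))
        = scale (1 / (\<xi>\<^sup>2 * \<xi>s)) (A (A (As u)) + scale 2 (A (As (A u))) + As (A (A u)))"
      by (simp add: X_def Y_def D.operator_simps D.scale_right_distrib power2_eq_square mult_ac)
    then show ?thesis
      unfolding double_anticommutator \<xi>[symmetric] using nonzero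
      by (simp add: Y_def power2_eq_square)
  qed
  moreover have "Y (Y (X u)) + scale 2 (Y (X (Y u))) + X (Y (Y u)) = scale 4 (X u)" for u
  proof -
    have "Y (Y (X u)) + scale 2 (Y (X (Y u))) + X (Y (Y u))
        = scale (1 / (\<xi>s\<^sup>2 * \<xi>)) (As (As (A u)) + scale 2 (As (A (As u))) + A (As (As u)))"
      by (simp add: X_def Y_def D.operator_simps D.scale_right_distrib power2_eq_square mult_ac)
    then show ?thesis
      unfolding double_anticommutator_swapped \<xi>s[symmetric] using nonzero
      by (simp add: X_def power2_eq_square)
  qed
  ultimately have "generator_operators scale
      (\<lambda>g. case g of Gx \<Rightarrow> X | Gy \<Rightarrow> Y | Gz \<Rightarrow> (\<lambda>u. scale (1 / 2) (X (Y u) + Y (X u))))"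
    using linear by (intro D.generator_operatorsI) simp_all
  then interpret T: generator_operators scale
    "\<lambda>g. case g of Gx \<Rightarrow> X | Gy \<Rightarrow> Y | Gz \<Rightarrow> (\<lambda>u. scale (1 / 2) (X (Y u) + Y (X u)))" .
  have A: "A u = scale \<xi> (T.alg_act (alg_gen Gx) u)" and As: "As u = scale \<xi>s (T.alg_act (alg_gen Gy) u)"
    for u
    using nonzero by (simp_all add: T.alg_act_gen X_def Y_def)
  have "irreducible_module scale T.alg_act"
    unfolding irreducible_module_def
  proof (intro conjI allI impI)
    show "alg_module scale T.alg_act" by (rule T.alg_module_alg_act)
    show "(UNIV :: 'b set) \<noteq> {0}" using A_nonzero by (metis UNIV_I singletonD)
    fix W assume W: "D.subspace W \<and> (\<forall>p. \<forall>w\<in>W. T.alg_act p w \<in> W)"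
    then have "A u \<in> W" "As u \<in> W" if "u \<in> W" for u
      using that by (simp_all add: A As D.subspace_scale)
    with W show "W = {0} \<or> W = UNIV"
      using D.invariant_subspace_trivial inj_eigenvalues by blast
  qed
  then show ?thesis
    using nonzero by (auto simp: D.realizations_iff A As)
qed

text \<open>A realization is determined by its scalars, which range independently over two opposite
  nonzero values each.\<close>

lemma card_realizations: "card (realizations scale A As) = 4"
proof -
  have roots: "(2 * r)\<^sup>2 = t\<^sup>2 \<longleftrightarrow> r \<in> {t / 2, - t / 2}" for r t :: 'a
    unfolding power2_eq_iff by (auto simp: field_simps)
  have "inj_on (\<lambda>(\<xi>, \<xi>s, act). (\<xi>, \<xi>s)) (realizations scale A As)"
    by (auto simp: inj_on_def intro: realization_unique)
  then have "card (realizations scale A As)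
      = card ((\<lambda>(\<xi>, \<xi>s, act). (\<xi>, \<xi>s)) ` realizations scale A As)"
    by (simp add: card_image)
  also have "(\<lambda>(\<xi>, \<xi>s, act). (\<xi>, \<xi>s)) ` realizations scale A As = {s / 2, - s / 2} \<times> {s' / 2, - s' / 2}"
  proof (intro set_eqI iffI)
    fix q :: "'a \<times> 'a"
    assume "q \<in> (\<lambda>(\<xi>, \<xi>s, act). (\<xi>, \<xi>s)) ` realizations scale A As"
    then obtain act where "(fst q, snd q, act) \<in> realizations scale A As" by auto
    from realization_scalars[OF this] have "fst q \<in> {s / 2, - s / 2}" "snd q \<in> {s' / 2, - s' / 2}"
      by (simp_all only: roots)
    then show "q \<in> {s / 2, - s / 2} \<times> {s' / 2, - s' / 2}" unfolding mem_Times_iff by blast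
  next
    fix q assume "q \<in> {s / 2, - s / 2} \<times> {s' / 2, - s' / 2}"
    then have "(2 * fst q)\<^sup>2 = s\<^sup>2" "(2 * snd q)\<^sup>2 = s'\<^sup>2"
      by (simp_all only: roots mem_Times_iff)
    then obtain act where "(fst q, snd q, act) \<in> realizations scale A As"
      using realization_exists by blast
    then show "q \<in> (\<lambda>(\<xi>, \<xi>s, act). (\<xi>, \<xi>s)) ` realizations scale A As"
      by (intro image_eqI) auto
  qed
  also have "card \<dots> = 4"
  proof -
    have "card {t / 2, - t / 2} = 2" if "t \<noteq> 0" for t :: 'a
    proof -
      have "t / 2 \<noteq> - t / 2"
      proof
        assume "t / 2 = - t / 2"
        then have "t / 2 + t / 2 = 0" by (metis add.right_inverse minus_divide_left)
        then have "2 * (t / 2) = 0" by (simp only: mult_2)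
        then show False using that by simp
      qed
      then show ?thesis unfolding card_2_iff by blast
    qed
    from this[OF s_nonzero] this[OF s'_nonzero] show ?thesis
      by (simp only: card_cartesian_product)
  qed
  finally show ?thesis .
qed

end

section \<open>Types B and AB\<close>

text \<open>As z is half of xy + yx, its matrix in an eigenbasis of x is that of y with each entry
  multiplied by the half-sum of the two eigenvalues involved.\<close>

lemma (in generator_operators) z_on_neighbours:
  assumes "T Gx u0 = scale x0 u0" "T Gx u1 = scale x1 u1" "T Gx u2 = scale x2 u2"
    and "T Gy u1 = scale p u0 + scale r u1 + scale q u2"
    and "x0 + x1 = 2 * z0" "x1 + x2 = 2 * z2" and two: "(2 :: 'k) \<noteq> 0"
  shows "T Gz u1 = scale (z0 * p) u0 + scale (x1 * r) u1 + scale (z2 * q) u2"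
proof -
  have "scale 2 (T Gz u1) = scale ((x0 + x1) * p) u0 + scale (2 * x1 * r) u1 + scale ((x1 + x2) * q) u2"
    unfolding T_xy[symmetric] assms(2)
    by (simp add: linear_T_simps assms(1-4) distrib_left distrib_right scale_left_distrib
        scale_right_distrib mult_ac add_ac) (simp add: scale_two scale_right_distrib flip: scale_scale)
  also have "\<dots> = scale 2 (scale (z0 * p) u0 + scale (x1 * r) u1 + scale (z2 * q) u2)"
    by (simp add: assms(5,6) scale_right_distrib mult.assoc)
  finally show ?thesis using two by simp
qed

text \<open>The four labels correspond to the four sign choices for x and y; the sign for z is the
  product, as for an anticommutator.\<close>

lemma ex_hat:
  assumes "e \<in> {1, - 1 :: 'a::field_char_0}" "f \<in> {1, - 1}"
  shows "\<exists>n. hat Gx n = e \<and> hat Gy n = f \<and> hat Gz n = e * f"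
proof -
  consider "e = 1" "f = 1" | "e = 1" "f = -1" | "e = -1" "f = 1" | "e = -1" "f = -1"
    using assms by blast
  then show ?thesis
  proof cases
    case 1
    then show ?thesis by (intro exI[of _ None]) (simp add: hat_def)
  next
    case 2
    then show ?thesis by (intro exI[of _ "Some Gx"]) (simp add: hat_def)
  next
    case 3
    then show ?thesis by (intro exI[of _ "Some Gy"]) (simp add: hat_def)
  next
    case 4
    then show ?thesis by (intro exI[of _ "Some Gz"]) (simp add: hat_def)
  qed
qed

context bannai_ito_bases
begin

text \<open>Reversal moves the corner entry to index 0, so it respects the orientation only when
  that entry vanishes. For even d it changes the sign of \<open>s\<close>.\<close>

lemma reversed:
  assumes "a (int d) = 0"
  shows "bannai_ito_bases scale d A As (\<lambda>i. v (int d - i)) v' (\<lambda>i. k (int d - i)) k'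
    (\<lambda>i. \<theta> (int d - i)) \<theta>' (\<lambda>i. a (int d - i)) a' (\<lambda>i. c (int d - i)) b' (\<lambda>i. b (int d - i)) c'"
proof -
  have "a i = 0" for i
    using a_zero[of i] D.a_outside[of i] assms by (cases i "int d" rule: linorder_cases) auto
  then show ?thesis
    by (intro bannai_ito_bases.intro leonard_bases.intro D.reversed Ds.tridiagonal_basis_axioms
        bannai_ito_bases_axioms.intro adjacent_sums_alternate_reversed diameter BI BI' a'_zero)
qed

text \<open>With this sign of \<open>\<xi>\<close> the eigenvalues appear in the order of B(d).
  Taking \<open>\<xi>s\<close> for \<open>\<eta>\<close> in \<open>ladder_basis\<close> absorbs the
  sign of \<open>\<xi>s\<close>, and z follows from x and y.\<close>

lemma type_Bd_if_scalar_positive: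
  assumes real: "(\<xi>, \<xi>s, act) \<in> realizations scale A As"
    and "a (int d) = 0" and \<xi>: "2 * \<xi> = s"
  shows "type_Bd scale d act"
proof -
  note gen = realization_generators[OF real]
  interpret T: generator_operators scale "\<lambda>g. act (alg_gen g)" by (rule gen(1))
  have "\<xi> \<noteq> 0" "\<xi>s \<noteq> 0" and irr: "irreducible_module scale act"
    and x: "\<And>u. act (alg_gen Gx) u = scale (1 / \<xi>) (A u)"
    and y: "\<And>u. act (alg_gen Gy) u = scale (1 / \<xi>s) (As u)"
    using real by (simp_all add: D.realizations_iff)
  have "b (i - 1) * c i = \<xi>s\<^sup>2 * of_int i * of_int (int d - i + 1)" if "i \<in> {1..int d}" for i
  proof -
    have "4 * (b (i - 1) * c i) = (2 * \<xi>s)\<^sup>2 * of_int i * of_int (int d - i + 1)"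
      using bipartite_parameters(3)[OF assms(2), of i] realization_scalars(2)[OF real] that by simp
    also have "\<dots> = 4 * (\<xi>s\<^sup>2 * of_int i * of_int (int d - i + 1))"
      by (simp only: power_mult_distrib mult.assoc) simp
    finally show ?thesis by (metis mult_left_cancel zero_neq_numeral)
  qed
  with \<open>\<xi>s \<noteq> 0\<close> obtain u where u: "Defs.indexed_basis scale d (\<lambda>i. u (int i))"
    "\<And>i. i \<notin> {0..int d} \<Longrightarrow> u i = 0"
    and A_u: "\<And>i. A (u i) = scale (\<theta> i) (u i)"
    and As_u: "\<And>i. i \<in> {0..int d} \<Longrightarrow> As (u i) = scale (\<xi>s * of_int (int d - i + 1)) (u (i - 1))
      + scale (a i) (u i) + scale (\<xi>s * of_int (i + 1)) (u (i + 1))"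
    using D.ladder_basis[of \<xi>s "int d"] by blast
  define X :: "int \<Rightarrow> 'a" where "X i = (-1) powi i * of_int (int d - 2 * i)" for i
  have x_u: "act (alg_gen Gx) (u i) = scale (X i) (u i)" for i
  proof (cases "i \<in> {0..int d}")
    case True
    have "2 * \<theta> i = (-1) powi i * (2 * \<theta> 0 - 2 * s * of_int i)"
      unfolding eigenvalue_formula[OF True] by (simp add: algebra_simps)
    also have "\<dots> = 2 * (\<xi> * X i)"
      using bipartite_parameters(1)[OF assms(2)] by (simp add: X_def algebra_simps flip: \<xi>)
    finally have "\<theta> i = \<xi> * X i" by simp
    then show ?thesis using \<open>\<xi> \<noteq> 0\<close> by (simp add: x A_u)
  qed (simp add: u(2) x linear_map_zero[OF D.linear_A])
  have y_u: "act (alg_gen Gy) (u i) = scale (of_int (int d - i + 1)) (u (i - 1)) + scale 0 (u i)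
      + scale (of_int (i + 1)) (u (i + 1))" if "i \<in> {0..int d}" for i
  proof -
    have "a i = 0" using a_zero[of i] assms(2) that by (cases "i = int d") auto
    then show ?thesis using As_u[OF that] \<open>\<xi>s \<noteq> 0\<close> by (simp add: y D.scale_right_distrib)
  qed
  have z_u: "act (alg_gen Gz) (u i) = scale ((-1) powi (i - 1) * of_int (int d - i + 1)) (u (i - 1))
      + scale (X i * 0) (u i) + scale ((-1) powi i * of_int (i + 1)) (u (i + 1))"
    if "i \<in> {0..int d}" for i
    \<comment> \<open>The neighbouring eigenvalues \<open>X i\<close> and \<open>X (i + 1)\<close>
      add up to twice \<open>(-1) powi i\<close>.\<close>
    by (rule T.z_on_neighbours[OF x_u x_u x_u y_u[OF that]])
      (simp_all add: X_def minus_one_powi algebra_simps)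
  show ?thesis
    unfolding type_Bd_def
  proof (intro conjI irr exI[of _ u] u(1) ballI)
    show "u (- 1) = 0" "u (int d + 1) = 0" by (simp_all add: u(2))
    fix i assume "i \<in> {0..int d}"
    then show "act (alg_gen Gx) (u i) = scale ((- 1) powi i * of_int (int d - 2 * i)) (u i)"
      and "act (alg_gen Gy) (u i) =
        scale (of_int (int d - i + 1)) (u (i - 1)) + scale (of_int (i + 1)) (u (i + 1))"
      and "act (alg_gen Gz) (u i) = scale ((- 1) powi (i - 1) * of_int (int d - i + 1)) (u (i - 1))
        + scale ((- 1) powi i * of_int (i + 1)) (u (i + 1))"
      using x_u[of i] y_u[of i] z_u[of i] by (simp_all add: X_def)
  qed
qed

text \<open>The formulas of B(d) leave no sign to choose for x, so the case
  \<open>2 * \<xi> = - s\<close> is reduced to the other one by reversing the eigenbasis.\<close>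

lemma type_B_realization:
  assumes real: "(\<xi>, \<xi>s, act) \<in> realizations scale A As" and a: "a (int d) = 0"
  shows "type_B scale act"
proof -
  have even: "even d" by (rule bipartite_parameters(2)[OF a])
  have "2 * \<xi> = s \<or> 2 * \<xi> = - s"
    using realization_scalars(1)[OF real] by (simp only: power2_eq_iff)
  then have "type_Bd scale d act"
  proof
    assume "2 * \<xi> = s"
    then show ?thesis by (rule type_Bd_if_scalar_positive[OF real a])
  next
    assume "2 * \<xi> = - s"
    moreover obtain n where n: "d = Suc n" using diameter by (cases d) auto
    have "\<theta> (int d) + \<theta> (int d - 1) = - s"
      using adjacent_sum_sign[of n] even by (simp add: n add.commute)
    ultimately have "2 * \<xi> = bannai_ito_bases.s (\<lambda>i. \<theta> (int d - i))"
      by (simp add: bannai_ito_bases.s_def[OF reversed[OF a]])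
    moreover have "a (int d - int d) = 0" using a_zero[of 0] diameter by simp
    ultimately show ?thesis
      using bannai_ito_bases.type_Bd_if_scalar_positive[OF reversed[OF a] real] by blast
  qed
  then show ?thesis using even by (auto simp: type_B_def)
qed

text \<open>Two signs are open: that of \<open>s / (2 * \<xi>)\<close> and that of the corner entry
  relative to \<open>\<xi>s\<close>. Multiplied by \<open>(-1) ^ d\<close>, they become the values
  \<open>e\<close> and \<open>f\<close> of \<open>hat\<close> at x and y, which select n.\<close>

lemma type_AB_realization:
  assumes real: "(\<xi>, \<xi>s, act) \<in> realizations scale A As" and a: "a (int d) \<noteq> 0"
  shows "type_AB scale act"
proof -
  note gen = realization_generators[OF real] and param = almost_bipartite_parameters[OF a]
  interpret T: generator_operators scale "\<lambda>g. act (alg_gen g)" by (rule gen(1))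
  have "\<xi> \<noteq> 0" "\<xi>s \<noteq> 0" and irr: "irreducible_module scale act"
    and x: "\<And>u. act (alg_gen Gx) u = scale (1 / \<xi>) (A u)"
    and y: "\<And>u. act (alg_gen Gy) u = scale (1 / \<xi>s) (As u)"
    using real by (simp_all add: D.realizations_iff)
  define m :: 'a where "m = (-1) ^ d"
  have m_sign: "m \<in> {1, -1}" by (auto simp: m_def minus_one_power_iff)
  then have m: "m * m = 1" by auto
  have sign: "p / q \<in> {1, -1}" if "p\<^sup>2 = q\<^sup>2" "q \<noteq> 0" for p q :: 'a
    using that by (auto simp only: power2_eq_iff) simp_all
  have sign_mult: "p * q \<in> {1, -1}" if "p \<in> {1, -1}" "q \<in> {1, -1}" for p q :: 'a
    using that by auto
  have d1: "of_nat (d + 1) \<noteq> (0 :: 'a)" by (simp only: of_nat_eq_0_iff)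
  define e where "e = m * (s / (2 * \<xi>))"
  have "s / (2 * \<xi>) \<in> {1, -1}"
    using \<open>\<xi> \<noteq> 0\<close> by (intro sign realization_scalars(1)[OF real, symmetric]) simp
  then have e: "e \<in> {1, -1}" unfolding e_def by (rule sign_mult[OF m_sign])
  define f where "f = m * (2 * a (int d) / (2 * \<xi>s * of_nat (d + 1)))"
  have "(2 * a (int d))\<^sup>2 = (2 * \<xi>s * of_nat (d + 1))\<^sup>2"
    unfolding param(3) power_mult_distrib[of _ "of_nat (d + 1)"] realization_scalars(2)[OF real] ..
  moreover have "2 * \<xi>s * of_nat (d + 1) \<noteq> 0" using \<open>\<xi>s \<noteq> 0\<close> d1 by (simp del: of_nat_add)
  ultimately have "2 * a (int d) / (2 * \<xi>s * of_nat (d + 1)) \<in> {1, -1}" by (rule sign)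
  then have f: "f \<in> {1, -1}" unfolding f_def by (rule sign_mult[OF m_sign])
  obtain n where n: "hat Gx n = e" "hat Gy n = f" "hat Gz n = e * f"
    using ex_hat[OF e f] by blast
  \<comment> \<open>Chosen so that the corner entry becomes
    \<open>\<eta> * of_int (int d + 1)\<close>, which continues the pattern of raising coefficients
    to i = d.\<close>
  define \<eta> where "\<eta> = f * m * \<xi>s"
  have \<eta>: "\<eta> \<noteq> 0" "\<eta>\<^sup>2 = \<xi>s\<^sup>2" "\<eta> / \<xi>s = f * m"
    using \<open>\<xi>s \<noteq> 0\<close> f m_sign unfolding \<eta>_def by auto
  have a_d: "a (int d) = \<eta> * of_int (int d + 1)"
  proof -
    have "\<eta> * of_nat (d + 1) = (m * m) * a (int d)"
      using \<open>\<xi>s \<noteq> 0\<close> d1 by (simp add: \<eta>_def f_def del: of_nat_add)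
    then show ?thesis using m by (simp add: add.commute)
  qed
  have "b (i - 1) * c i = \<eta>\<^sup>2 * of_int i * of_int (2 * int d + 1 - i + 1)" if "i \<in> {1..int d}" for i
  proof -
    have "4 * (b (i - 1) * c i) = (2 * \<xi>s)\<^sup>2 * of_int i * of_int (2 * int d - i + 2)"
      using param(2)[of i] realization_scalars(2)[OF real] that by simp
    also have "\<dots> = 4 * (\<eta>\<^sup>2 * of_int i * of_int (2 * int d - i + 2))"
      unfolding \<eta>(2) by (simp only: power_mult_distrib mult.assoc) simp
    finally have "b (i - 1) * c i = \<eta>\<^sup>2 * of_int i * of_int (2 * int d - i + 2)"
      by (metis mult_left_cancel zero_neq_numeral)
    moreover have "2 * int d + 1 - i + 1 = 2 * int d - i + 2" by simp
    ultimately show ?thesis by (simp only:)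
  qed
  with \<eta>(1) obtain u where u: "Defs.indexed_basis scale d (\<lambda>i. u (int i))"
    "\<And>i. i \<notin> {0..int d} \<Longrightarrow> u i = 0"
    and A_u: "\<And>i. A (u i) = scale (\<theta> i) (u i)"
    and As_u: "\<And>i. i \<in> {0..int d} \<Longrightarrow> As (u i) = scale (\<eta> * of_int (2 * int d + 1 - i + 1)) (u (i - 1))
      + scale (a i) (u i) + scale (\<eta> * of_int (i + 1)) (u (i + 1))"
    using D.ladder_basis[of \<eta> "2 * int d + 1"] by blast
  define X :: "int \<Rightarrow> 'a" where
    "X i = e * (-1) powi (int d + i) * of_int (2 * int d - 2 * i + 1)" for i
  have powi: "(-1) powi (int d + i) = m * (-1) powi i" for i
    by (simp add: m_def power_int_add)
  have "s = 2 * \<xi> * e * m" using \<open>\<xi> \<noteq> 0\<close> m by (simp add: e_def mult_ac)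
  have x_u: "act (alg_gen Gx) (u i) = scale (X i) (u i)" for i
  proof (cases "i \<in> {0..int d}")
    case True
    have "2 * \<theta> i = (-1) powi i * (2 * \<theta> 0 - 2 * s * of_int i)"
      unfolding eigenvalue_formula[OF True] by (simp add: algebra_simps)
    also have "\<dots> = (-1) powi i * s * of_int (2 * int d - 2 * i + 1)"
      unfolding param(1) by (simp add: algebra_simps)
    also have "\<dots> = 2 * (\<xi> * X i)"
      unfolding X_def powi \<open>s = _\<close> by (simp only: mult_ac)
    finally have "\<theta> i = \<xi> * X i" by simp
    then show ?thesis using \<open>\<xi> \<noteq> 0\<close> by (simp add: x A_u)
  qed (simp add: u(2) x linear_map_zero[OF D.linear_A])
  define r :: "int \<Rightarrow> 'a" where "r i = (if i = int d then f * m * of_int (int d + 1) else 0)" for i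
  have y_u: "act (alg_gen Gy) (u i) = scale (f * m * of_int (2 * int d - i + 2)) (u (i - 1))
      + scale (r i) (u i) + scale (f * m * of_int (i + 1)) (u (i + 1))" if "i \<in> {0..int d}" for i
  proof -
    have "a i = \<eta> * (if i = int d then of_int (int d + 1) else 0)"
      using a_zero[of i] a_d that by (cases "i = int d") auto
    then have "a i / \<xi>s = \<eta> / \<xi>s * (if i = int d then of_int (int d + 1) else 0)"
      by (simp only: times_divide_eq_left)
    then have "a i / \<xi>s = r i" unfolding \<eta>(3) by (simp add: r_def)
    moreover have "\<eta> * q / \<xi>s = f * m * q" for q
      using \<eta>(3) by (metis times_divide_eq_left)
    moreover have "2 * int d + 1 - i + 1 = 2 * int d - i + 2" by simp
    moreover have "act (alg_gen Gy) (u i)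
        = scale (\<eta> * of_int (2 * int d + 1 - i + 1) / \<xi>s) (u (i - 1))
          + scale (a i / \<xi>s) (u i) + scale (\<eta> * of_int (i + 1) / \<xi>s) (u (i + 1))"
      unfolding y As_u[OF that] D.scale_right_distrib D.scale_scale by simp
    ultimately show ?thesis by (simp only:)
  qed
  have z_u: "act (alg_gen Gz) (u i)
      = scale (e * m * (-1) powi (i - 1) * (f * m * of_int (2 * int d - i + 2))) (u (i - 1))
      + scale (X i * r i) (u i)
      + scale (e * m * (-1) powi i * (f * m * of_int (i + 1))) (u (i + 1))"
    if "i \<in> {0..int d}" for i
    by (rule T.z_on_neighbours[OF x_u x_u x_u y_u[OF that]])
      (unfold X_def powi, simp_all add: minus_one_powi algebra_simps)
  \<comment> \<open>Setting the vector at d + 1 equal to the one at d makes the raising term at i =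
    d a diagonal term; this is how the formulas of type AB encode the corner entry.\<close>
  define w where "w = u(int d + 1 := u (int d))"
  have w: "w i = u i" if "i \<le> int d" for i using that by (simp add: w_def)
  have coeff: "e * m * p * (f * m * q) = e * f * (p * q)" for p q
    using m by (metis (no_types) mult.assoc mult.commute mult_1)
  have "type_ABdn scale d n act"
    unfolding type_ABdn_def n
  proof (intro conjI irr exI[of _ w] ballI)
    show "Defs.indexed_basis scale d (\<lambda>i. w (int i))"
    proof -
      have "(\<lambda>i. w (int i)) ` {..d} = (\<lambda>i. u (int i)) ` {..d}"
        by (rule image_cong) (simp_all add: w)
      moreover have "inj_on (\<lambda>i. w (int i)) {..d} \<longleftrightarrow> inj_on (\<lambda>i. u (int i)) {..d}"
        by (rule inj_on_cong) (simp add: w)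
      ultimately show ?thesis using u(1) unfolding indexed_basis_def by simp
    qed
    show "w (- 1) = 0" by (simp add: w u(2))
    show "w (int d + 1) = w (int d)" by (simp add: w_def)
    fix i assume i: "i \<in> {0..int d}"
    show "act (alg_gen Gx) (w i) = scale (e * (- 1) powi (int d + i) * of_int (2 * int d - 2 * i + 1)) (w i)"
      using i x_u[of i] by (simp add: w X_def)
    show "act (alg_gen Gy) (w i) = scale (f * (- 1) ^ d)
        (scale (of_int (2 * int d - i + 2)) (w (i - 1)) + scale (of_int (i + 1)) (w (i + 1)))"
    proof (cases "i = int d")
      case True
      then show ?thesis
        using y_u[OF i] by (simp add: w_def u(2) r_def m_def D.scale_right_distrib)
    next
      case False
      then show ?thesis
        using y_u[OF i] i by (simp add: w r_def m_def D.scale_right_distrib)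
    qed
    show "act (alg_gen Gz) (w i) = scale (e * f)
        (scale ((- 1) powi (i - 1) * of_int (2 * int d - i + 2)) (w (i - 1)) +
         scale ((- 1) powi i * of_int (i + 1)) (w (i + 1)))"
    proof (cases "i = int d")
      case True
      \<comment> \<open>At i = d the x-eigenvalue is the sign \<open>e\<close>, so the diagonal
        entry of z there is \<open>e\<close> times that of y, which is the raising coefficient
        required.\<close>
      have "X i * r i = e * f * ((- 1) powi i * of_int (i + 1))"
        unfolding X_def r_def powi using True by (simp add: mult_ac m)
      then show ?thesis
        using True z_u[OF i] by (simp add: w_def u(2) coeff D.scale_right_distrib del: of_int_add of_int_diff)
    next
      case False
      then show ?thesis
        using z_u[OF i] i by (simp add: w r_def coeff D.scale_right_distrib del: of_int_add of_int_diff)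
    qed
  qed
  then show ?thesis by (auto simp: type_AB_def)
qed

end

section \<open>Standard bases of a Leonard pair\<close>

text \<open>Converts matrices over natural indices into the zero-padded integer form. Columns hold
  the images of basis vectors, so \<open>b\<close> is read below the diagonal and \<open>c\<close>
  above it.\<close>

lemma standard_basis_obtain:
  fixes scale :: "'k::field_char_0 \<Rightarrow> 'v::ab_group_add \<Rightarrow> 'v"
  assumes "Vector_Spaces.linear scale scale A" "Vector_Spaces.linear scale scale As"
    and u: "standard_basis scale A As u"
  defines "d \<equiv> diam scale"
  obtains v k \<theta> a b c where "tridiagonal_basis scale d A As v k \<theta> a b c"
    and "\<And>i. i \<le> d \<Longrightarrow> \<theta> (int i) = matrix_wrt scale d u A i i"
    and "\<And>i. i \<le> d \<Longrightarrow> a (int i) = matrix_wrt scale d u As i i"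
proof -
  interpret vector_space scale using assms(1) by (simp add: Vector_Spaces.linear_iff)
  define M where "M = matrix_wrt scale d u A"
  define N where "N = matrix_wrt scale d u As"
  have inj: "inj_on u {..d}" and indep: "independent (u ` {..d})" and span: "span (u ` {..d}) = UNIV"
    and diag: "\<And>i j. i \<le> d \<Longrightarrow> j \<le> d \<Longrightarrow> i \<noteq> j \<Longrightarrow> M i j = 0"
    and tri: "\<And>i j. i \<le> d \<Longrightarrow> j \<le> d \<Longrightarrow> i + 1 < j \<or> j + 1 < i \<Longrightarrow> N i j = 0"
    and irred: "\<And>i. i < d \<Longrightarrow> N i (i + 1) \<noteq> 0 \<and> N (i + 1) i \<noteq> 0"
    using u by (auto simp: standard_basis_def indexed_basis_def diagonal_mat_def
        irred_tridiagonal_mat_def M_def N_def d_def)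
  define v where "v i = (if i \<in> {0..int d} then u (nat i) else 0)" for i
  define k where "k i w = (if i \<in> {0..int d} then representation (u ` {..d}) w (u (nat i)) else 0)"
    for i w
  define \<theta> where "\<theta> i = M (nat i) (nat i)" for i
  define a where "a i = (if i \<in> {0..int d} then N (nat i) (nat i) else 0)" for i
  define b where "b i = (if i \<in> {0..<int d} then N (nat i + 1) (nat i) else 0)" for i
  define c where "c i = (if i \<in> {1..int d} then N (nat i - 1) (nat i) else 0)" for i
  have sum_repr: "w = (\<Sum>i\<le>d. scale (representation (u ` {..d}) w (u i)) (u i))" for w
  proof -
    have "(\<Sum>x\<in>u ` {..d}. scale (representation (u ` {..d}) w x) x) = w"
      using indep span by (intro sum_representation_eq) auto
    then show ?thesis by (simp add: sum.reindex[OF inj])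
  qed
  have reindex: "(\<Sum>i\<in>{0..int d}. g (nat i)) = (\<Sum>i\<le>d. g i)" for g :: "nat \<Rightarrow> 'v"
    by (rule sum.reindex_bij_witness[of _ int nat]) auto
  have expansion: "w = (\<Sum>i\<in>{0..int d}. scale (k i w) (v i))" for w
    by (subst sum_repr, subst reindex[symmetric]) (simp add: k_def v_def)
  have "tridiagonal_basis scale d A As v k \<theta> a b c"
  proof (intro tridiagonal_basis.intro tridiagonal_basis_axioms.intro vector_space_axioms assms(1,2)
      expansion)
    show "k i (x + y) = k i x + k i y" for i x y
      using indep span by (simp add: k_def representation_add)
    show "k i (scale r x) = r * k i x" for i r x
      using indep span by (simp add: k_def representation_scale)
    show "k i (v j) = (if i = j \<and> i \<in> {0..int d} then 1 else 0)" for i j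
      using inj_onD[OF inj, of "nat i" "nat j"] indep
      by (auto simp: k_def v_def representation_basis representation_zero eq_nat_nat_iff nat_le_iff)
    show "A (v i) = scale (\<theta> i) (v i)" for i
    proof (cases "i \<in> {0..int d}")
      case True
      have "A (u (nat i)) = (\<Sum>j\<le>d. scale (M j (nat i)) (u j))"
        using sum_repr[of "A (u (nat i))"] by (simp add: M_def matrix_wrt_def)
      also have "\<dots> = (\<Sum>j\<le>d. if j = nat i then scale (M j j) (u j) else 0)"
        using True diag by (intro sum.cong) auto
      also have "\<dots> = scale (\<theta> i) (u (nat i))" using True by (simp add: \<theta>_def nat_le_iff)
      finally show ?thesis using True by (simp add: v_def)
    qed (auto simp: v_def linear_map_zero[OF assms(1)])
    show "As (v i) = scale (c i) (v (i - 1)) + scale (a i) (v i) + scale (b i) (v (i + 1))" for i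
    proof (cases "i \<in> {0..int d}")
      case True
      define n where "n = nat i"
      have n: "i = int n" "n \<le> d" using True by (auto simp: n_def)
      have "As (u n) = (\<Sum>j\<le>d. scale (N j n) (u j))"
        using sum_repr[of "As (u n)"] by (simp add: N_def matrix_wrt_def)
      \<comment> \<open>At n = 0 the truncated \<open>n - 1\<close> equals n, but the extra summand
        is zero by \<open>c i = 0\<close>. At n = d the index n + 1 leaves the range, and
        \<open>b i = 0\<close>.\<close>
      also have "\<dots> = (\<Sum>j\<le>d. (if j = n - 1 then scale (c i) (v (i - 1)) else 0)
          + (if j = n then scale (a i) (v i) else 0)
          + (if j = n + 1 then scale (b i) (v (i + 1)) else 0))"
      proof (rule sum.cong[OF refl])
        fix j assume "j \<in> {..d}"
        then consider "j + 1 < n" | "n + 1 < j" | "j + 1 = n" | "j = n" | "j = n + 1" by force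
        then show "scale (N j n) (u j) = (if j = n - 1 then scale (c i) (v (i - 1)) else 0)
          + (if j = n then scale (a i) (v i) else 0)
          + (if j = n + 1 then scale (b i) (v (i + 1)) else 0)"
          using n \<open>j \<in> {..d}\<close> tri[of j n]
          by cases (auto simp: a_def b_def c_def v_def nat_add_distrib nat_diff_distrib)
      qed
      also have "\<dots> = scale (c i) (v (i - 1)) + scale (a i) (v i) + scale (b i) (v (i + 1))"
        using n by (auto simp: sum.distrib b_def)
      finally show ?thesis using n by (simp add: v_def)
    qed (auto simp: v_def a_def b_def c_def linear_map_zero[OF assms(2)])
    show "a i = 0" if "i \<notin> {0..int d}" for i
      using that by (auto simp: a_def)
    show "b i = 0 \<longleftrightarrow> i \<notin> {0..<int d}" for i
      using irred[of "nat i"] by (auto simp: b_def nat_less_iff)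
    show "c i = 0 \<longleftrightarrow> i \<notin> {1..int d}" for i
    proof (cases "i \<in> {1..int d}")
      case True
      then have "nat i - 1 < d" "nat i - 1 + 1 = nat i" by auto
      with True irred[of "nat i - 1"] show ?thesis by (simp add: c_def)
    qed (auto simp: c_def)
  qed
  then show thesis
    by (rule that) (simp_all add: \<theta>_def a_def M_def N_def)
qed

text \<open>The Bannai/Ito condition is known for \<open>w\<close>, the diagonal entries for
  \<open>v\<close>. The two eigenvalue orders agree up to reversal, which preserves the condition; a
  reversal of \<open>v\<close>, if necessary, puts a nonzero end entry last.\<close>

lemma (in tridiagonal_basis) oriented_basis:
  assumes inj: "inj_on \<theta> {0..int d}"
    and "tridiagonal_basis scale d A As w l \<eta> p q r" "inj_on \<eta> {0..int d}"
    and \<eta>: "adjacent_sums_alternate d \<eta>"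
    and interior: "\<And>i. 0 < i \<Longrightarrow> i < int d \<Longrightarrow> a i = 0" and ends: "a 0 = 0 \<or> a (int d) = 0"
  obtains v\<^sub>1 k\<^sub>1 \<theta>\<^sub>1 a\<^sub>1 b\<^sub>1 c\<^sub>1
    where "tridiagonal_basis scale d A As v\<^sub>1 k\<^sub>1 \<theta>\<^sub>1 a\<^sub>1 b\<^sub>1 c\<^sub>1"
    and "adjacent_sums_alternate d \<theta>\<^sub>1" and "\<And>i. i < int d \<Longrightarrow> a\<^sub>1 i = 0"
    and "a\<^sub>1 (int d) = 0 \<longleftrightarrow> a 0 = 0 \<and> a (int d) = 0"
proof -
  have cong: "adjacent_sums_alternate d f" if "\<forall>i\<in>{0..int d}. g i = f i" "adjacent_sums_alternate d g"
    for f g :: "int \<Rightarrow> 'k"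
    using that by (auto simp: adjacent_sums_alternate_def)
  from eigenvalues_unique_up_to_reversal[OF assms(2) inj assms(3)]
  have \<theta>: "adjacent_sums_alternate d \<theta>"
  proof
    assume "\<forall>i\<in>{0..int d}. \<eta> i = \<theta> i"
    then show ?thesis using \<eta> by (rule cong)
  next
    assume "\<forall>i\<in>{0..int d}. \<eta> i = \<theta> (int d - i)"
    then have "adjacent_sums_alternate d (\<lambda>i. \<theta> (int d - i))" using \<eta> by (rule cong)
    from adjacent_sums_alternate_reversed[OF this] show ?thesis by simp
  qed
  have a_left: "a i = 0" if "i < 0" for i using a_outside[of i] that by simp
  have a_right: "a i = 0" if "i > int d" for i using a_outside[of i] that by simp
  show thesis
  proof (cases "a 0 = 0")
    case True
    have "a i = 0" if "i < int d" for i
      using True interior[of i] a_left[of i] that by (cases i "0 :: int" rule: linorder_cases) auto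
    then show thesis using True by (intro that[OF tridiagonal_basis_axioms \<theta>]) auto
  next
    case False
    have "a (int d - i) = 0" if "i < int d" for i
      using False ends interior[of "int d - i"] a_right[of "int d - i"] that
      by (cases i "0 :: int" rule: linorder_cases) auto
    then show thesis
      using False
      by (intro that[OF reversed adjacent_sums_alternate_reversed[OF \<theta>]]) auto
  qed
qed

lemma inj_eigenvalues_of_leonard_pair:
  fixes scale :: "'k::field_char_0 \<Rightarrow> 'v::ab_group_add \<Rightarrow> 'v"
  assumes "leonard_pair scale A As" and "tridiagonal_basis scale (diam scale) A As v k \<theta> a b c"
  shows "inj_on \<theta> {0..int (diam scale)}"
proof -
  from assms(1) obtain u where linear: "Vector_Spaces.linear scale scale A"
    "Vector_Spaces.linear scale scale As" and u: "standard_basis scale As A u"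
    by (auto simp: leonard_pair_def)
  obtain v' k' \<theta>' a' b' c' where "tridiagonal_basis scale (diam scale) As A v' k' \<theta>' a' b' c'"
    by (rule standard_basis_obtain[OF linear(2,1) u])
  with assms(2) show ?thesis
    by (intro leonard_bases.inj_eigenvalues[OF leonard_bases.intro])
qed

text \<open>\<open>bannai_ito_type\<close> and the two bipartite notions each provide bases of their
  own: \<open>w\<close> comes from the former, \<open>u\<close> from the latter. The result is one
  basis with both properties.\<close>

lemma oriented_standard_basis:
  fixes scale :: "'k::field_char_0 \<Rightarrow> 'v::ab_group_add \<Rightarrow> 'v"
  assumes pair: "leonard_pair scale A As"
    and w: "standard_basis scale A As w" and u: "standard_basis scale A As u"
    and BI: "\<And>i. 2 \<le> i \<and> i \<le> diam scale - 1 \<Longrightarrow>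
      (matrix_wrt scale (diam scale) w A (i - 2) (i - 2)
        - matrix_wrt scale (diam scale) w A (i + 1) (i + 1)) /
      (matrix_wrt scale (diam scale) w A (i - 1) (i - 1)
        - matrix_wrt scale (diam scale) w A i i) = - 1"
    and diag: "bipartite_mat (diam scale) (matrix_wrt scale (diam scale) u As) \<or>
      almost_bipartite_mat (diam scale) (matrix_wrt scale (diam scale) u As)"
    and d: "3 \<le> diam scale"
  obtains v k \<theta> a b c where "tridiagonal_basis scale (diam scale) A As v k \<theta> a b c"
    and "adjacent_sums_alternate (diam scale) \<theta>" and "\<And>i. i < int (diam scale) \<Longrightarrow> a i = 0"
    and "bipartite_mat (diam scale) (matrix_wrt scale (diam scale) u As) \<Longrightarrow> a (int (diam scale)) = 0"
    and "almost_bipartite_mat (diam scale) (matrix_wrt scale (diam scale) u As) \<Longrightarrow>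
      a (int (diam scale)) \<noteq> 0"
proof -
  let ?d = "diam scale"
  from pair have linear: "Vector_Spaces.linear scale scale A" "Vector_Spaces.linear scale scale As"
    by (auto simp: leonard_pair_def)
  obtain x l \<eta> p q r where W: "tridiagonal_basis scale ?d A As x l \<eta> p q r"
    and \<eta>: "\<And>i. i \<le> ?d \<Longrightarrow> \<eta> (int i) = matrix_wrt scale ?d w A i i"
    using standard_basis_obtain[OF linear w] by metis
  obtain v k \<theta> a b c where U: "tridiagonal_basis scale ?d A As v k \<theta> a b c"
    and a: "\<And>i. i \<le> ?d \<Longrightarrow> a (int i) = matrix_wrt scale ?d u As i i"
    using standard_basis_obtain[OF linear u] by metis
  have alternate: "adjacent_sums_alternate ?d \<eta>"
    unfolding adjacent_sums_alternate_def
  proof (intro allI impI)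
    fix i assume i: "0 \<le> i \<and> i + 3 \<le> int ?d"
    define n where "n = nat i"
    have n: "i = int n" "n + 3 \<le> ?d" using i by (auto simp: n_def)
    have "(\<eta> (int n) - \<eta> (int (n + 3))) / (\<eta> (int (n + 1)) - \<eta> (int (n + 2))) = - 1"
      using BI[of "n + 2"] n \<eta>[of n] \<eta>[of "n + 1"] \<eta>[of "n + 2"] \<eta>[of "n + 3"]
      by (simp add: eval_nat_numeral)
    \<comment> \<open>Division by zero yields 0, so a quotient equal to -1 has a nonzero
      denominator.\<close>
    moreover from this have "\<eta> (int (n + 1)) - \<eta> (int (n + 2)) \<noteq> 0" by (metis div_by_0 neg_equal_0_iff_equal zero_neq_one)
    ultimately have "\<eta> (int n) - \<eta> (int (n + 3)) = - 1 * (\<eta> (int (n + 1)) - \<eta> (int (n + 2)))"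
      by (metis nonzero_divide_eq_eq)
    then have "\<eta> (int n) + \<eta> (int (n + 1)) = \<eta> (int (n + 2)) + \<eta> (int (n + 3))" by algebra
    then show "\<eta> i + \<eta> (i + 1) = \<eta> (i + 2) + \<eta> (i + 3)" by (simp add: n add.commute)
  qed
  have a': "a i = matrix_wrt scale ?d u As (nat i) (nat i)" if "i \<in> {0..int ?d}" for i
    using a[of "nat i"] that by (simp add: nat_le_iff)
  have interior: "a i = 0" if "0 < i" "i < int ?d" for i
  proof -
    have "1 \<le> nat i" "nat i < ?d" using that by auto
    then show ?thesis
      using diag a'[of i] that by (auto simp: bipartite_mat_def almost_bipartite_mat_def)
  qed
  have ends: "a 0 = 0 \<or> a (int ?d) = 0"
    using diag a'[of 0] a'[of "int ?d"] by (auto simp: bipartite_mat_def almost_bipartite_mat_def)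
  note inj = inj_eigenvalues_of_leonard_pair[OF pair]
  obtain v k \<theta> a'' b c where *: "tridiagonal_basis scale ?d A As v k \<theta> a'' b c"
    "adjacent_sums_alternate ?d \<theta>" "\<And>i. i < int ?d \<Longrightarrow> a'' i = 0"
    and "a'' (int ?d) = 0 \<longleftrightarrow> a 0 = 0 \<and> a (int ?d) = 0"
    using tridiagonal_basis.oriented_basis[OF U inj[OF U] W inj[OF W] alternate interior ends]
    by metis
  then show thesis
    using a'[of 0] a'[of "int ?d"]
    by (intro that[OF *]) (auto simp: bipartite_mat_def almost_bipartite_mat_def)
qed

text \<open>\<open>oriented_standard_basis\<close> is applied to the pair and to the exchanged pair.
  The corner entry of \<open>As\<close> is recorded because it decides the module type.\<close>

lemma bannai_ito_bases_obtain:
  fixes scale :: "'k::field_char_0 \<Rightarrow> 'v::ab_group_add \<Rightarrow> 'v"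
  assumes BI: "bannai_ito_type scale A As" and d: "3 \<le> diam scale"
    and u: "standard_basis scale A As u" and u': "standard_basis scale As A u'"
    and diag: "bipartite_mat (diam scale) (matrix_wrt scale (diam scale) u As) \<or>
      almost_bipartite_mat (diam scale) (matrix_wrt scale (diam scale) u As)"
    and diag': "bipartite_mat (diam scale) (matrix_wrt scale (diam scale) u' A) \<or>
      almost_bipartite_mat (diam scale) (matrix_wrt scale (diam scale) u' A)"
  obtains v v' k k' \<theta> \<theta>' a a' b b' c c'
    where "bannai_ito_bases scale (diam scale) A As v v' k k' \<theta> \<theta>' a a' b b' c c'"
    and "bipartite_mat (diam scale) (matrix_wrt scale (diam scale) u As) \<Longrightarrow> a (int (diam scale)) = 0"
    and "almost_bipartite_mat (diam scale) (matrix_wrt scale (diam scale) u As) \<Longrightarrow>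
      a (int (diam scale)) \<noteq> 0"
proof -
  have pair: "leonard_pair scale A As" "leonard_pair scale As A"
    using BI by (auto simp: bannai_ito_type_def leonard_pair_def)
  obtain w w' where w: "standard_basis scale A As w" and w': "standard_basis scale As A w'"
    and BIs: "\<And>i. 2 \<le> i \<and> i \<le> diam scale - 1 \<Longrightarrow>
      (matrix_wrt scale (diam scale) w A (i - 2) (i - 2)
        - matrix_wrt scale (diam scale) w A (i + 1) (i + 1)) /
      (matrix_wrt scale (diam scale) w A (i - 1) (i - 1)
        - matrix_wrt scale (diam scale) w A i i) = - 1"
      "\<And>i. 2 \<le> i \<and> i \<le> diam scale - 1 \<Longrightarrow>
      (matrix_wrt scale (diam scale) w' As (i - 2) (i - 2)
        - matrix_wrt scale (diam scale) w' As (i + 1) (i + 1)) /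
      (matrix_wrt scale (diam scale) w' As (i - 1) (i - 1)
        - matrix_wrt scale (diam scale) w' As i i) = - 1"
    using BI unfolding bannai_ito_type_def Let_def by blast
  show thesis
    by (rule oriented_standard_basis[OF pair(1) w u BIs(1) diag d];
        rule oriented_standard_basis[OF pair(2) w' u' BIs(2) diag' d])
      (blast intro: that bannai_ito_bases.intro leonard_bases.intro bannai_ito_bases_axioms.intro d)+
qed

theorem theorem8p16:
  fixes scale :: "'k::{alg_closed_field, field_char_0} \<Rightarrow> 'v::ab_group_add \<Rightarrow> 'v"
    and Basis :: "'v set"
    and A As :: "'v \<Rightarrow> 'v"
  assumes "finite_dimensional_vector_space scale Basis"
    and "vector_space.dim scale (UNIV :: 'v set) > 0"
    and "leonard_pair scale A As"
    and "bannai_ito_type scale A As"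
    and "diam scale \<ge> 3"
    and "totally_bipartite scale A As \<or> totally_almost_bipartite scale A As"
  shows "(\<exists>\<xi> \<xi>s act. (\<xi>, \<xi>s, act) \<in> realizations scale A As) \<and>
     (totally_bipartite scale A As \<longrightarrow>
        (\<forall>\<xi> \<xi>s act. (\<xi>, \<xi>s, act) \<in> realizations scale A As \<longrightarrow> type_B scale act)) \<and>
     (totally_almost_bipartite scale A As \<longrightarrow>
        (\<forall>\<xi> \<xi>s act. (\<xi>, \<xi>s, act) \<in> realizations scale A As \<longrightarrow> type_AB scale act)) \<and>
     card (realizations scale A As) = 4 \<and>
     (\<forall>\<xi> \<xi>s act \<xi>' \<xi>s' act'.
        (\<xi>, \<xi>s, act) \<in> realizations scale A As \<longrightarrow>
        (\<xi>', \<xi>s', act') \<in> realizations scale A As \<longrightarrow>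
        \<xi>' \<in> {\<xi>, - \<xi>} \<and> \<xi>s' \<in> {\<xi>s, - \<xi>s}) \<and>
     (\<forall>\<xi> \<xi>s act act'.
        (\<xi>, \<xi>s, act) \<in> realizations scale A As \<longrightarrow>
        (\<xi>, \<xi>s, act') \<in> realizations scale A As \<longrightarrow> act' = act)"
proof -
  let ?d = "diam scale"
  \<comment> \<open>Each alternative gets its own bases, since each claim about types assumes just
    that alternative.\<close>
  have bipartite: "\<exists>v v' k k' \<theta> \<theta>' a a' b b' c c'.
      bannai_ito_bases scale ?d A As v v' k k' \<theta> \<theta>' a a' b b' c c' \<and> a (int ?d) = 0"
    if "totally_bipartite scale A As"
    using that bannai_ito_bases_obtain[OF assms(4,5)] unfolding totally_bipartite_def by metis
  have almost: "\<exists>v v' k k' \<theta> \<theta>' a a' b b' c c'.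
      bannai_ito_bases scale ?d A As v v' k k' \<theta> \<theta>' a a' b b' c c' \<and> a (int ?d) \<noteq> 0"
    if "totally_almost_bipartite scale A As"
    using that bannai_ito_bases_obtain[OF assms(4,5)] unfolding totally_almost_bipartite_def by metis
  from bipartite almost assms(6) obtain v v' k k' \<theta> \<theta>' a a' b b' c c'
    where "bannai_ito_bases scale ?d A As v v' k k' \<theta> \<theta>' a a' b b' c c'"
    by blast
  then interpret bannai_ito_bases scale ?d A As v v' k k' \<theta> \<theta>' a a' b b' c c' .
  have card: "card (realizations scale A As) = 4" by (rule card_realizations)
  then have "realizations scale A As \<noteq> {}" by (metis card.empty zero_neq_numeral)
  then obtain t where "t \<in> realizations scale A As" by blast
  then have "\<exists>\<xi> \<xi>s act. (\<xi>, \<xi>s, act) \<in> realizations scale A As" by (cases t) auto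
  moreover have "\<xi>' \<in> {\<xi>, - \<xi>} \<and> \<xi>s' \<in> {\<xi>s, - \<xi>s}"
    if real: "(\<xi>, \<xi>s, act) \<in> realizations scale A As" "(\<xi>', \<xi>s', act') \<in> realizations scale A As"
    for \<xi> \<xi>s act \<xi>' \<xi>s' act'
  proof -
    \<comment> \<open>For both realizations these squares are the same \<open>s\<^sup>2\<close> and
      \<open>s'\<^sup>2\<close>.\<close>
    have "(2 * \<xi>')\<^sup>2 = (2 * \<xi>)\<^sup>2" "(2 * \<xi>s')\<^sup>2 = (2 * \<xi>s)\<^sup>2"
      by (simp_all only: realization_scalars[OF real(1)] realization_scalars[OF real(2)])
    then have "\<xi>'\<^sup>2 = \<xi>\<^sup>2" "\<xi>s'\<^sup>2 = \<xi>s\<^sup>2" by (simp_all add: power_mult_distrib)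
    then show ?thesis by (simp add: power2_eq_iff)
  qed
  moreover have "type_B scale act"
    if "totally_bipartite scale A As" "(\<xi>, \<xi>s, act) \<in> realizations scale A As" for \<xi> \<xi>s act
    using bipartite[OF that(1)] bannai_ito_bases.type_B_realization[OF _ that(2)] by blast
  moreover have "type_AB scale act"
    if "totally_almost_bipartite scale A As" "(\<xi>, \<xi>s, act) \<in> realizations scale A As" for \<xi> \<xi>s act
    using almost[OF that(1)] bannai_ito_bases.type_AB_realization[OF _ that(2)] by blast
  ultimately show ?thesis
    using card realization_unique by (intro conjI allI impI) simp_all
qed

end
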